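(* Let $A_1,\dots,A_m\in\mathbb{S}^n$ be such that $I_n,A_1,\dots,A_m$ are linearly independent, with centered Gram matrix $G_0$. Let $\mathbf{b}\in\operatorname{int}\mathscr{M}$ and $f(\mathbf{y})=\log\operatorname{tr}\exp A(\mathbf{y})-\mathbf{b}^T\mathbf{y}$. Let $\mathbf{y}_0\in\mathbb{R}^m$, let $\mathscr{S}:=\{\mathbf{y}\in\mathbb{R}^m: f(\mathbf{y})\le f(\mathbf{y}_0)\}$, and define $$\delta:=\operatorname{dist}(\mathbf{b},\partial\mathscr{M})=\min_{\|\mathbf{v}\|_2=1}\bigl(\lambda_{\max}(A(\mathbf{v}))-\mathbf{b}^T\mathbf{v}\bigr)>0 .$$ Then $f$ is $\alpha$-strongly convex on $\mathscr{S}$, with $$\alpha:=\frac{\lambda_{\min}(G_0)}{n}\exp\!\left(-\frac{\sqrt{2\,\lambda_{\max}(G_0)}}{\delta}\,f(\mathbf{y}_0)\right)>0 .$$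
   Context: $\mathbb{S}^n$ is the space of real symmetric $n\times n$ matrices, and $\mathbb{S}^n_1=\{X\in\mathbb{S}^n: X\succeq 0,\ \operatorname{tr}X=1\}$. $A(\mathbf{y})=\sum_{i=1}^m y_iA_i$, $\mathcal{A}(X)=(\operatorname{tr}(A_iX))_{i=1,\dots,m}$, and the moment body is $\mathscr{M}=\mathcal{A}(\mathbb{S}^n_1)\subset\mathbb{R}^m$, with boundary $\partial\mathscr{M}$ and interior $\operatorname{int}\mathscr{M}$ in $\mathbb{R}^m$; distances are Euclidean. The centered Gram matrix is $G_0=[\operatorname{tr}(A_i^0A_j^0)]_{i,j=1}^m$, where $A_i^0=A_i-\tfrac{\operatorname{tr}A_i}{n}I_n$. $\lambda_{\max},\lambda_{\min}$ denote largest and smallest eigenvalues. The smooth function $f$ is called $\alpha$-strongly convex on a convex set $\mathscr{S}$ if $\nabla^2 f(\mathbf{y})\succeq\alpha I_m$ for all $\mathbf{y}\in\mathscr{S}$. *)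

theory Defs
  imports "HOL-Analysis.Analysis"
begin

definition symmetric_matrix :: "real^'n^'n \<Rightarrow> bool" where
  "symmetric_matrix X \<longleftrightarrow> transpose X = X"

definition psd :: "real^'n^'n \<Rightarrow> bool" where
  "psd X \<longleftrightarrow> symmetric_matrix X \<and> (\<forall>v. 0 \<le> v \<bullet> (X *v v))"

definition eigenvalues :: "real^'n^'n \<Rightarrow> real set" where
  "eigenvalues X = {l. \<exists>v. v \<noteq> 0 \<and> X *v v = l *\<^sub>R v}"

(* Only used for symmetric matrices, whose eigenvalues form a finite nonempty set. *)
definition lambda_max :: "real^'n^'n \<Rightarrow> real" where
  "lambda_max X = Max (eigenvalues X)"

definition lambda_min :: "real^'n^'n \<Rightarrow> real" where
  "lambda_min X = Min (eigenvalues X)"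

(* The overloaded product on vectors is componentwise, so ^ is not the matrix power,
   and exp is not available on this type. *)
primrec matrix_pow :: "real^'n^'n \<Rightarrow> nat \<Rightarrow> real^'n^'n" where
  "matrix_pow X 0 = mat 1"
| "matrix_pow X (Suc k) = X ** matrix_pow X k"

definition matrix_exp :: "real^'n^'n \<Rightarrow> real^'n^'n" where
  "matrix_exp X = (\<Sum>k. (1 / fact k) *\<^sub>R matrix_pow X k)"

(* Independence of an indexed family: in contrast to independence of its range,
   it excludes repeated members. *)
definition independent_family :: "('i \<Rightarrow> 'a::real_vector) \<Rightarrow> bool" where
  "independent_family F \<longleftrightarrow> inj F \<and> independent (range F)"

definition matrix_pencil :: "('m::finite \<Rightarrow> real^'n^'n) \<Rightarrow> real^'m \<Rightarrow> real^'n^'n" where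
  "matrix_pencil A y = (\<Sum>i\<in>UNIV. y $ i *\<^sub>R A i)"

definition spectraplex :: "(real^'n^'n) set" where
  "spectraplex = {X. psd X \<and> trace X = 1}"

definition moment_map :: "('m::finite \<Rightarrow> real^'n^'n) \<Rightarrow> real^'n^'n \<Rightarrow> real^'m" where
  "moment_map A X = (\<chi> i. trace (A i ** X))"

definition moment_body :: "('m::finite \<Rightarrow> real^'n^'n) \<Rightarrow> (real^'m) set" where
  "moment_body A = moment_map A ` spectraplex"

definition centered :: "real^'n^'n \<Rightarrow> real^'n^'n" where
  "centered X = X - (trace X / real CARD('n)) *\<^sub>R mat 1"

definition centered_gram :: "('m::finite \<Rightarrow> real^'n^'n) \<Rightarrow> real^'m^'m" where
  "centered_gram A = (\<chi> i j. trace (centered (A i) ** centered (A j)))"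

definition partial_deriv :: "'m::finite \<Rightarrow> (real^'m \<Rightarrow> real) \<Rightarrow> real^'m \<Rightarrow> real" where
  "partial_deriv i f y = frechet_derivative f (at y) (axis i 1)"

primrec cont_diff :: "nat \<Rightarrow> (real^'m::finite \<Rightarrow> real) \<Rightarrow> bool" where
  "cont_diff 0 f \<longleftrightarrow> continuous_on UNIV f"
| "cont_diff (Suc k) f \<longleftrightarrow> f differentiable_on UNIV \<and> (\<forall>i. cont_diff k (partial_deriv i f))"

definition smooth :: "(real^'m::finite \<Rightarrow> real) \<Rightarrow> bool" where
  "smooth f \<longleftrightarrow> (\<forall>k. cont_diff k f)"

definition hessian :: "(real^'m::finite \<Rightarrow> real) \<Rightarrow> real^'m \<Rightarrow> real^'m^'m" where
  "hessian f y = (\<chi> i j. partial_deriv i (partial_deriv j f) y)"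

(* Smoothness of f and convexity of S are part of the notion, so that the Hessian
   is meaningful whenever the predicate holds. *)
definition strongly_convex_on :: "real \<Rightarrow> (real^'m::finite) set \<Rightarrow> (real^'m \<Rightarrow> real) \<Rightarrow> bool" where
  "strongly_convex_on \<alpha> S f \<longleftrightarrow>
     smooth f \<and> convex S \<and> (\<forall>y\<in>S. psd (hessian f y - \<alpha> *\<^sub>R mat 1))"

definition log_partition ::
    "('m::finite \<Rightarrow> real^'n^'n) \<Rightarrow> real^'m \<Rightarrow> real^'m \<Rightarrow> real" where
  "log_partition A b y = ln (trace (matrix_exp (matrix_pencil A y))) - b \<bullet> y"

(* Unlike an infimum, this asserts that the minimum of g over D is attained. *)
definition is_minimum_on :: "real \<Rightarrow> ('a \<Rightarrow> real) \<Rightarrow> 'a set \<Rightarrow> bool" where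
  "is_minimum_on d g D \<longleftrightarrow> d \<in> g ` D \<and> (\<forall>v\<in>D. d \<le> g v)"

end

theory Submission
  imports Defs
begin

text \<open>
  Write \<open>Z y = tr (exp A(y))\<close>, so that the function under study is \<open>f y = ln (Z y) - b \<bullet> y\<close>.

  \<^bold>\<open>The Hessian.\<close>  Fix \<open>y\<close> and a direction \<open>v\<close>.  Replacing \<open>A(y)\<close> by \<open>P = A(y) - \<lambda>\<^sub>m\<^sub>i\<^sub>n I\<close> and \<open>A(v)\<close> by
  \<open>C = A(v) - c I\<close> changes \<open>ln Z\<close> along the line \<open>y + t v\<close> only by an affine function of \<open>t\<close>.  So the
  second derivative of \<open>f\<close> in the direction \<open>v\<close> is that of \<open>ln \<psi>\<close> with \<open>\<psi> t = tr (exp (P + t C))\<close>,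
  and for the right \<open>c\<close> the first derivative of \<open>\<psi>\<close> vanishes at \<open>0\<close>, which leaves \<open>\<psi>'' / \<psi>\<close>.  The
  coefficient of \<open>t\<^sup>2\<close> in the exponential series is a combination, with nonnegative weights, of
  traces of products that contain \<open>C\<close> twice and \<open>P\<close> otherwise.  Each of these is, up to a cyclic
  rotation, the trace of a product of two positive semidefinite matrices, \<open>C P\<^sup>j C\<close> and \<open>P\<^sup>k\<close>, hence
  nonnegative, and the shortest of them contributes \<open>tr (C\<^sup>2)\<close> to \<open>\<psi>''\<close>.  This gives \<open>\<psi>'' \<ge> tr (C\<^sup>2)\<close>
  (\<open>trace_exp_perturbation\<close>) without any formula for the derivative of the matrix exponential.
  Since \<open>tr (C\<^sup>2)\<close> is smallest when \<open>C\<close> has trace zero, and since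
  \<open>tr (exp P) \<le> n exp (\<lambda>\<^sub>m\<^sub>a\<^sub>x - \<lambda>\<^sub>m\<^sub>i\<^sub>n)\<close> for the eigenvalues of \<open>A(y)\<close>, the Hessian is bounded below
  by the centered Gram form divided by \<open>n exp (\<lambda>\<^sub>m\<^sub>a\<^sub>x - \<lambda>\<^sub>m\<^sub>i\<^sub>n)\<close> (\<open>hessian_log_partition_ge\<close>).

  \<^bold>\<open>The constant.\<close>  The spread \<open>\<lambda>\<^sub>m\<^sub>a\<^sub>x - \<lambda>\<^sub>m\<^sub>i\<^sub>n\<close> of \<open>A(y)\<close> is at most \<open>\<surd>2\<close> times the Frobenius norm of the
  centered \<open>A(y)\<close>, hence at most \<open>\<surd>(2 \<lambda>\<^sub>m\<^sub>a\<^sub>x(G\<^sub>0))\<close> times the norm of \<open>y\<close>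
  (\<open>eigenvalue_spread_pencil_le\<close>).  The function \<open>v \<mapsto> \<lambda>\<^sub>m\<^sub>a\<^sub>x(A(v))\<close> is the support function of the moment
  body, so its excess over \<open>b \<bullet> v\<close> on unit vectors has the minimum \<open>\<delta>\<close>, the distance of \<open>b\<close> to the
  boundary (\<open>infdist_frontier_is_minimum_support\<close>).  With \<open>Z y \<ge> exp (\<lambda>\<^sub>m\<^sub>a\<^sub>x(A(y)))\<close> this makes \<open>f\<close> grow
  at least like \<open>\<delta>\<close> times the norm (\<open>log_partition_ge\<close>), which bounds the sublevel set by \<open>f y0 / \<delta>\<close>.

  \<^bold>\<open>Smoothness.\<close>  Expanding the powers of \<open>A(y)\<close> writes \<open>Z\<close> as a power series indexed by words
  over the index set of the family \<open>A\<close>.  Series of this kind whose coefficients grow at most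
  geometrically in the length of the word are closed under partial derivatives, because
  differentiation inserts a letter into the word at every position
  (\<open>word_series_has_derivative\<close>).  The same calculus, used with the two letters \<open>P\<close> and \<open>C\<close>,
  provides the second derivative of \<open>\<psi>\<close>.
\<close>

section \<open>Spectral theory of real symmetric matrices\<close>

lemma symmetric_matrix_inner:
  fixes X :: "real^'n^'n"
  assumes "symmetric_matrix X"
  shows "x \<bullet> (X *v y) = (X *v x) \<bullet> y"
  using assms unfolding symmetric_matrix_def
  by (metis dot_lmul_matrix transpose_matrix_vector)

text \<open>
  The basis is indexed by the row index type itself, so that sums over the basis run over
  \<open>UNIV\<close> and eigenvalues are listed with multiplicity.
\<close>

definition eigenbasis :: "real^'n^'n \<Rightarrow> ('n \<Rightarrow> real^'n) \<Rightarrow> ('n \<Rightarrow> real) \<Rightarrow> bool" where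
  "eigenbasis X u d \<longleftrightarrow>
     (\<forall>i j. u i \<bullet> u j = (if i = j then 1 else 0)) \<and> (\<forall>i. X *v u i = d i *\<^sub>R u i)"

text \<open>
  A maximiser of the Rayleigh quotient on the unit sphere of the subspace is an eigenvector:
  its defect \<open>X u - l u\<close> lies in the subspace again and is a direction in which the quotient
  cannot increase to first order.
\<close>

lemma exists_eigenvector_in_invariant_subspace:
  fixes X :: "real^'n^'n"
  assumes X: "symmetric_matrix X" and V: "subspace V" and inv: "\<And>x. x \<in> V \<Longrightarrow> X *v x \<in> V"
    and x0: "x0 \<in> V" "x0 \<noteq> 0"
  shows "\<exists>u l. u \<in> V \<and> norm u = 1 \<and> X *v u = l *\<^sub>R u"
proof -
  let ?K = "V \<inter> sphere 0 1"
  have "compact ?K"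
    using closed_subspace[OF V] by (metis compact_Int_closed compact_sphere inf_commute)
  moreover have "?K \<noteq> {}"
  proof -
    have "x0 /\<^sub>R norm x0 \<in> ?K" using x0 V by (simp add: subspace_scale)
    then show ?thesis by blast
  qed
  moreover have "continuous_on ?K (\<lambda>x. x \<bullet> (X *v x))"
    by (intro continuous_intros linear_continuous_on) simp
  ultimately obtain u where u: "u \<in> ?K" and max: "\<And>x. x \<in> ?K \<Longrightarrow> x \<bullet> (X *v x) \<le> u \<bullet> (X *v u)"
    using continuous_attains_sup[of ?K] by blast
  define l where "l = u \<bullet> (X *v u)"
  have uV: "u \<in> V" and nu: "norm u = 1" using u by auto
  have Q: "w \<bullet> (X *v w) \<le> l * (w \<bullet> w)" if w: "w \<in> V" for w
  proof (cases "w = 0")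
    case False
    have "(w /\<^sub>R norm w) \<bullet> (X *v (w /\<^sub>R norm w)) \<le> l"
      unfolding l_def using False w V by (intro max) (simp add: subspace_scale)
    then have "(w \<bullet> (X *v w)) / (norm w)\<^sup>2 \<le> l"
      by (simp add: matrix_vector_mult_scaleR power2_eq_square divide_inverse mult_ac)
    then show ?thesis using False
      by (simp add: divide_le_eq power2_norm_eq_inner)
  qed simp
  define w where "w = X *v u - l *\<^sub>R u"
  have wV: "w \<in> V" unfolding w_def using V uV inv by (simp add: subspace_diff subspace_scale)
  \<comment> \<open>The inequality for \<open>u + t w\<close>: as \<open>u\<close> gives equality, no term of order zero in \<open>t\<close> is left,
    and a linear term on the left would dominate the quadratic one for small \<open>t\<close>.\<close>
  have quad: "t * (2 * (w \<bullet> w)) \<le> t\<^sup>2 * (l * (w \<bullet> w) - w \<bullet> (X *v w))" for t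
  proof -
    have "(u + t *\<^sub>R w) \<bullet> (X *v (u + t *\<^sub>R w)) \<le> l * ((u + t *\<^sub>R w) \<bullet> (u + t *\<^sub>R w))"
      using V uV wV by (intro Q) (simp add: subspace_add subspace_scale)
    moreover have "u \<bullet> (X *v w) = w \<bullet> (X *v u)"
      using symmetric_matrix_inner[OF X, of u w] by (simp add: inner_commute)
    moreover have "w \<bullet> (X *v u) = w \<bullet> w + l * (u \<bullet> w)"
      unfolding w_def by (simp add: inner_diff_left inner_diff_right inner_commute algebra_simps)
    moreover have "u \<bullet> u = 1" using nu by (simp add: norm_eq_1)
    ultimately show ?thesis
      using l_def by (simp add: matrix_vector_right_distrib matrix_vector_mult_scaleR inner_add_left
          inner_add_right inner_commute power2_eq_square algebra_simps)
  qed
  have "w \<bullet> w = 0"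
  proof (rule ccontr)
    assume "w \<bullet> w \<noteq> 0"
    then have p: "w \<bullet> w > 0" by (simp add: order_less_le)
    \<comment> \<open>\<open>R\<close> bounds the quadratic coefficient, and the \<open>1\<close> keeps it positive.\<close>
    define R where "R = \<bar>l * (w \<bullet> w) - w \<bullet> (X *v w)\<bar> + 1"
    have Rp: "R > 0" unfolding R_def by simp
    define t where "t = (w \<bullet> w) / R"
    have tp: "t > 0" unfolding t_def using p Rp by simp
    have "t * (2 * (w \<bullet> w)) \<le> t\<^sup>2 * R"
      using quad[of t] by (rule order_trans) (auto intro!: mult_left_mono simp: R_def)
    then have "2 * (w \<bullet> w) \<le> t * R" using tp by (simp add: power2_eq_square)
    then show False using p Rp by (simp add: t_def)
  qed
  then have "X *v u = l *\<^sub>R u" by (simp add: w_def)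
  then show ?thesis using uV nu by blast
qed

text \<open>
  The spectral theorem.  As long as the eigenvectors found do not span the space, their
  orthogonal complement is a nonzero invariant subspace, which contains a further one.
\<close>

lemma eigenbasis_exists:
  fixes X :: "real^'n^'n"
  assumes X: "symmetric_matrix X"
  shows "\<exists>u d. eigenbasis X u d"
proof -
  let ?P = "\<lambda>B. finite B \<and> pairwise orthogonal B \<and> (\<forall>b\<in>B. norm b = 1 \<and> (\<exists>l. X *v b = l *\<^sub>R b))"
  have "\<exists>B. ?P B \<and> card B = k" if "k \<le> CARD('n)" for k
    using that
  proof (induction k)
    case 0
    then show ?case by (intro exI[of _ "{}"]) auto
  next
    case (Suc k)
    then obtain B where B: "?P B" "card B = k" by auto
    define V where "V = {x. \<forall>b\<in>B. orthogonal b x}"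
    have V: "subspace V" unfolding V_def by (rule subspace_orthogonal_to_vectors)
    have inv: "X *v x \<in> V" if "x \<in> V" for x
      unfolding V_def
    proof (intro CollectI ballI)
      fix b assume b: "b \<in> B"
      then obtain l where "X *v b = l *\<^sub>R b" using B by auto
      then have "b \<bullet> (X *v x) = l * (b \<bullet> x)" by (simp add: symmetric_matrix_inner[OF X])
      then show "orthogonal b (X *v x)" using that b by (simp add: V_def orthogonal_def)
    qed
    have "dim (span B) < CARD('n)"
      using Suc.prems B by (metis Suc_le_lessD dim_le_card' dim_span order_le_less_trans)
    then have "span B \<noteq> UNIV" by (metis dim_UNIV DIM_cart DIM_real mult.right_neutral less_irrefl)
    then have "span B \<subset> span (UNIV::(real^'n) set)" by auto
    from orthogonal_to_subspace_exists_gen[OF this]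
    obtain x0 where "x0 \<noteq> 0" "\<And>y. y \<in> span B \<Longrightarrow> orthogonal x0 y" by auto
    then have "x0 \<in> V" "x0 \<noteq> 0" by (auto simp: V_def orthogonal_commute span_base)
    from exists_eigenvector_in_invariant_subspace[OF X V inv this]
    obtain u l where u: "u \<in> V" "norm u = 1" "X *v u = l *\<^sub>R u" by auto
    have "u \<notin> B" using u by (force simp: V_def orthogonal_def)
    moreover have "?P (insert u B)"
      using B u by (auto simp: V_def pairwise_insert orthogonal_commute)
    ultimately show ?case using B by (intro exI[of _ "insert u B"]) auto
  qed
  then obtain B where B: "?P B" "card B = CARD('n)" by blast
  then obtain u where u: "bij_betw u (UNIV::'n set) B"
    by (metis finite_same_card_bij finite_class.finite_UNIV)
  have uB: "u i \<in> B" for i using u by (auto simp: bij_betw_def)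
  then have "\<exists>l. X *v u i = l *\<^sub>R u i" for i using B by auto
  then obtain d where "\<And>i. X *v u i = d i *\<^sub>R u i" by metis
  moreover have "u i \<bullet> u j = (if i = j then 1 else 0)" for i j
  proof (cases "i = j")
    case True
    then show ?thesis using B uB by (simp add: norm_eq_1)
  next
    case False
    then have "u i \<noteq> u j" using u by (auto simp: bij_betw_def inj_on_def)
    then show ?thesis using B uB False by (auto simp: pairwise_def orthogonal_def)
  qed
  ultimately show ?thesis unfolding eigenbasis_def by blast
qed

lemma trace_orthonormal:
  fixes Y :: "real^'n^'n" and u :: "'n \<Rightarrow> real^'n"
  assumes "\<And>i j. u i \<bullet> u j = (if i = j then 1 else 0)"
  shows "trace Y = (\<Sum>i\<in>UNIV. u i \<bullet> (Y *v u i))"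
proof -
  define U :: "real^'n^'n" where "U = (\<chi> i. u i)"
  have 1: "U ** transpose U = mat 1"
    using assms by (simp add: vec_eq_iff matrix_matrix_mult_def transpose_def U_def mat_def inner_vec_def)
  then have 2: "transpose U ** U = mat 1" using matrix_left_right_inverse by blast
  have "(U ** (Y ** transpose U)) $ i $ i = u i \<bullet> (Y *v u i)" for i
    by (simp add: matrix_matrix_mult_def transpose_def U_def inner_vec_def matrix_vector_mult_def)
  then have "(\<Sum>i\<in>UNIV. u i \<bullet> (Y *v u i)) = trace (U ** (Y ** transpose U))"
    by (simp add: trace_def)
  also have "\<dots> = trace (Y ** (transpose U ** U))"
    by (subst trace_mul_sym) (simp add: matrix_mul_assoc)
  also have "\<dots> = trace Y" by (simp add: 2)
  finally show ?thesis by simp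
qed

lemma eigenbasis_trace:
  assumes "eigenbasis X u d"
  shows "trace Y = (\<Sum>i\<in>UNIV. u i \<bullet> (Y *v u i))"
  using assms unfolding eigenbasis_def by (intro trace_orthonormal) blast

lemma eigenbasis_norm: "eigenbasis X u d \<Longrightarrow> norm (u i) = 1"
  by (auto simp: eigenbasis_def norm_eq_1)

lemma eigenbasis_mult: "eigenbasis X u d \<Longrightarrow> X *v u i = d i *\<^sub>R u i"
  by (auto simp: eigenbasis_def)

lemma eigenbasis_expand:
  fixes x :: "real^'n"
  assumes E: "eigenbasis X u d"
  shows "x = (\<Sum>i\<in>UNIV. (x \<bullet> u i) *\<^sub>R u i)"
proof -
  have O: "u i \<bullet> u j = (if i = j then 1 else 0)" for i j using E by (auto simp: eigenbasis_def)
  have inj: "inj u"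
    by (rule injI) (metis O zero_neq_one)
  have P: "pairwise orthogonal (range u)"
    by (auto simp: pairwise_def orthogonal_def O)
  have N: "norm x = 1" if "x \<in> range u" for x
    using that eigenbasis_norm[OF E] by auto
  have "independent (range u)"
    using P N[of 0] by (intro pairwise_orthogonal_independent) auto
  then have "UNIV \<subseteq> span (range u)"
    using card_image[OF inj] by (intro card_ge_dim_independent) auto
  then have "(\<Sum>v\<in>range u. (x \<bullet> v) *\<^sub>R v) = x"
    by (intro orthonormal_basis_expand P N) auto
  then show ?thesis by (simp add: sum.reindex[OF inj])
qed

lemma eigenbasis_parseval:
  fixes x y :: "real^'n"
  assumes E: "eigenbasis X u d"
  shows "x \<bullet> y = (\<Sum>i\<in>UNIV. (x \<bullet> u i) * (y \<bullet> u i))"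
proof -
  have "x \<bullet> y = x \<bullet> (\<Sum>i\<in>UNIV. (y \<bullet> u i) *\<^sub>R u i)" using eigenbasis_expand[OF E] by metis
  then show ?thesis by (simp add: inner_sum_right mult.commute)
qed

lemma eigenbasis_quadratic_form:
  fixes x :: "real^'n"
  assumes E: "eigenbasis X u d"
  shows "x \<bullet> (X *v x) = (\<Sum>i\<in>UNIV. d i * (x \<bullet> u i)\<^sup>2)"
proof -
  have "X *v x = X *v (\<Sum>i\<in>UNIV. (x \<bullet> u i) *\<^sub>R u i)"
    using eigenbasis_expand[OF E] by metis
  also have "\<dots> = (\<Sum>i\<in>UNIV. ((x \<bullet> u i) * d i) *\<^sub>R u i)"
    by (simp add: linear_sum[OF matrix_vector_mul_linear] matrix_vector_mult_scaleR eigenbasis_mult[OF E])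
  finally show ?thesis
    by (simp add: inner_sum_right power2_eq_square mult_ac)
qed

lemma eigenbasis_range:
  assumes E: "eigenbasis X u d"
  shows "eigenvalues X = range d"
proof (intro equalityI subsetI)
  fix l assume "l \<in> eigenvalues X"
  then obtain v where v: "v \<noteq> 0" "X *v v = l *\<^sub>R v" by (auto simp: eigenvalues_def)
  obtain i where i: "v \<bullet> u i \<noteq> 0"
    using v(1) eigenbasis_expand[OF E, of v] by (metis (no_types, lifting) scale_eq_0_iff sum.neutral)
  \<comment> \<open>Compare the components of \<open>X v = l v\<close> along \<open>u i\<close>.\<close>
  have "l * (v \<bullet> u i) = (X *v v) \<bullet> u i" by (simp add: v)
  also have "\<dots> = (\<Sum>j\<in>UNIV. (v \<bullet> u j) *\<^sub>R (d j *\<^sub>R u j)) \<bullet> u i"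
    by (subst eigenbasis_expand[OF E, of v])
       (simp add: linear_sum[OF matrix_vector_mul_linear] matrix_vector_mult_scaleR eigenbasis_mult[OF E])
  also have "\<dots> = (\<Sum>j\<in>UNIV. if j = i then d i * (v \<bullet> u i) else 0)"
    using E unfolding inner_sum_left eigenbasis_def by (intro sum.cong) auto
  finally have "l = d i" using i by simp
  then show "l \<in> range d" by auto
next
  fix l assume "l \<in> range d"
  then obtain i where "l = d i" by auto
  then show "l \<in> eigenvalues X"
    using eigenbasis_mult[OF E] eigenbasis_norm[OF E, of i] unfolding eigenvalues_def
    by (metis (mono_tags, lifting) mem_Collect_eq norm_zero zero_neq_one)
qed

text \<open>
  Every power of \<open>X\<close> is a combination of the projections onto the basis vectors, so the matrix
  series reduces to the scalar exponential series of the eigenvalues.  This also settles its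
  convergence, on which the definition of \<open>matrix_exp\<close> by an infinite sum relies.
\<close>

lemma trace_matrix_exp_eigenbasis:
  fixes X :: "real^'n^'n"
  assumes E: "eigenbasis X u d"
  shows "(\<lambda>k. trace (matrix_pow X k) / fact k) sums trace (matrix_exp X)"
    and "trace (matrix_exp X) = (\<Sum>i\<in>UNIV. exp (d i))"
proof -
  have pow: "matrix_pow X k *v u i = (d i ^ k) *\<^sub>R u i" for k i
    by (induction k) (simp_all add: matrix_vector_mul_assoc[symmetric] matrix_vector_mult_scaleR eigenbasis_mult[OF E])
  define Pr :: "'n \<Rightarrow> real^'n^'n" where "Pr i = (\<chi> p q. u i $ p * u i $ q)" for i
  have Pr: "Pr i *v x = (u i \<bullet> x) *\<^sub>R u i" for i x
    by (simp add: vec_eq_iff Pr_def matrix_vector_mult_def inner_vec_def sum_distrib_left mult_ac)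
  have O: "u i \<bullet> u j = (if i = j then 1 else 0)" for i j using E by (auto simp: eigenbasis_def)
  have ext: "Y = Z" if "\<And>i. Y *v u i = Z *v u i" for Y Z :: "real^'n^'n"
  proof -
    have "Y *v x = Z *v x" for x
    proof -
      have "Y *v (\<Sum>i\<in>UNIV. (x \<bullet> u i) *\<^sub>R u i) = Z *v (\<Sum>i\<in>UNIV. (x \<bullet> u i) *\<^sub>R u i)"
        by (simp add: linear_sum[OF matrix_vector_mul_linear] matrix_vector_mult_scaleR that)
      then show ?thesis using eigenbasis_expand[OF E, of x] by simp
    qed
    then show ?thesis by (simp add: matrix_eq)
  qed
  have sumv: "(\<Sum>i\<in>UNIV. c i *\<^sub>R Pr i) *v x = (\<Sum>i\<in>UNIV. (c i * (u i \<bullet> x)) *\<^sub>R u i)" for c x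
  proof -
    have "(\<Sum>i\<in>I. c i *\<^sub>R Pr i) *v x = (\<Sum>i\<in>I. (c i * (u i \<bullet> x)) *\<^sub>R u i)" if "finite I" for I
      using that by induction (simp_all add: matrix_vector_mult_add_rdistrib scaleR_matrix_vector_assoc[symmetric] Pr)
    then show ?thesis by simp
  qed
  have powPr: "matrix_pow X k = (\<Sum>i\<in>UNIV. (d i ^ k) *\<^sub>R Pr i)" for k
  proof (rule ext)
    fix i
    have "(\<Sum>j\<in>UNIV. (d j ^ k * (u j \<bullet> u i)) *\<^sub>R u j) = (\<Sum>j\<in>UNIV. if j = i then (d i ^ k) *\<^sub>R u i else 0)"
      by (intro sum.cong) (auto simp: O)
    then show "matrix_pow X k *v u i = (\<Sum>j\<in>UNIV. (d j ^ k) *\<^sub>R Pr j) *v u i"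
      by (simp add: pow sumv)
  qed
  have "(\<lambda>k. (1 / fact k) *\<^sub>R matrix_pow X k) sums (\<Sum>i\<in>UNIV. exp (d i) *\<^sub>R Pr i)"
  proof -
    have "(\<lambda>k. \<Sum>i\<in>UNIV. (d i ^ k /\<^sub>R fact k) *\<^sub>R Pr i) sums (\<Sum>i\<in>UNIV. exp (d i) *\<^sub>R Pr i)"
      by (intro sums_sum sums_scaleR_left exp_converges)
    then show ?thesis
      by (simp only: powPr scaleR_sum_right scaleR_scaleR real_scaleR_def inverse_eq_divide)
  qed
  then have S: "(\<lambda>k. (1 / fact k) *\<^sub>R matrix_pow X k) sums matrix_exp X"
    unfolding matrix_exp_def by (intro summable_sums sums_summable)
  have lin: "bounded_linear (trace :: real^'n^'n \<Rightarrow> real)"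
    by (intro linear_conv_bounded_linear[THEN iffD1] linearI)
       (simp_all add: trace_add, simp add: trace_def sum_distrib_left)
  from bounded_linear.sums[OF lin S]
  show T: "(\<lambda>k. trace (matrix_pow X k) / fact k) sums trace (matrix_exp X)"
    by (simp add: linear_cmul[OF bounded_linear.linear[OF lin]])
  have "trace (matrix_pow X k) = (\<Sum>i\<in>UNIV. d i ^ k)" for k
    by (simp add: eigenbasis_trace[OF E] pow O)
  then have "(\<lambda>k. trace (matrix_pow X k) / fact k) = (\<lambda>k. \<Sum>i\<in>UNIV. d i ^ k /\<^sub>R fact k)"
    by (simp add: sum_distrib_left divide_inverse mult.commute)
  moreover have "(\<lambda>k. \<Sum>i\<in>UNIV. d i ^ k /\<^sub>R fact k) sums (\<Sum>i\<in>UNIV. exp (d i))"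
    by (intro sums_sum exp_converges)
  ultimately show "trace (matrix_exp X) = (\<Sum>i\<in>UNIV. exp (d i))"
    using sums_unique2[OF T] by simp
qed

lemma eigenbasis_lambda:
  assumes E: "eigenbasis X u d"
  shows "lambda_max X = Max (range d)" "lambda_min X = Min (range d)"
  using eigenbasis_range[OF E] by (simp_all add: lambda_max_def lambda_min_def)

lemma lambda_max_attained:
  fixes X :: "real^'n^'n"
  assumes "symmetric_matrix X"
  obtains v where "norm v = 1" "X *v v = lambda_max X *\<^sub>R v"
proof -
  obtain u d where E: "eigenbasis X u d" using eigenbasis_exists[OF assms] by blast
  have "Max (range d) \<in> range d" by (intro Max_in) auto
  then obtain i where "Max (range d) = d i" by (rule rangeE)
  then have "lambda_max X = d i" using eigenbasis_lambda[OF E] by simp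
  then show ?thesis using that[of "u i"] eigenbasis_norm[OF E] eigenbasis_mult[OF E] by simp
qed

lemma lambda_min_attained:
  fixes X :: "real^'n^'n"
  assumes "symmetric_matrix X"
  obtains v where "norm v = 1" "X *v v = lambda_min X *\<^sub>R v"
proof -
  obtain u d where E: "eigenbasis X u d" using eigenbasis_exists[OF assms] by blast
  have "Min (range d) \<in> range d" by (intro Min_in) auto
  then obtain i where "Min (range d) = d i" by (rule rangeE)
  then have "lambda_min X = d i" using eigenbasis_lambda[OF E] by simp
  then show ?thesis using that[of "u i"] eigenbasis_norm[OF E] eigenbasis_mult[OF E] by simp
qed

lemma lambda_bounds_quadratic_form:
  fixes X :: "real^'n^'n"
  assumes "symmetric_matrix X"
  shows "x \<bullet> (X *v x) \<le> lambda_max X * (x \<bullet> x)"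
    and "lambda_min X * (x \<bullet> x) \<le> x \<bullet> (X *v x)"
proof -
  obtain u d where E: "eigenbasis X u d" using eigenbasis_exists[OF assms] by blast
  have n: "x \<bullet> x = (\<Sum>i\<in>UNIV. (x \<bullet> u i)\<^sup>2)"
    by (simp add: eigenbasis_parseval[OF E, of x x] power2_eq_square)
  have "d i \<le> lambda_max X" "lambda_min X \<le> d i" for i
    by (auto simp: eigenbasis_lambda[OF E])
  then show "x \<bullet> (X *v x) \<le> lambda_max X * (x \<bullet> x)" "lambda_min X * (x \<bullet> x) \<le> x \<bullet> (X *v x)"
    unfolding n eigenbasis_quadratic_form[OF E] sum_distrib_left
    by (auto intro!: sum_mono mult_right_mono)
qed

lemma lambda_max_scaleR:
  fixes X :: "real^'n^'n"
  assumes "symmetric_matrix X" "0 \<le> c"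
  shows "lambda_max (c *\<^sub>R X) = c * lambda_max X"
proof -
  obtain u d where E: "eigenbasis X u d" using eigenbasis_exists[OF assms(1)] by blast
  have "eigenbasis (c *\<^sub>R X) u (\<lambda>i. c * d i)"
    using E by (simp add: eigenbasis_def scaleR_matrix_vector_assoc[symmetric])
  then have "lambda_max (c *\<^sub>R X) = Max (range (\<lambda>i. c * d i))" by (rule eigenbasis_lambda)
  also have "range (\<lambda>i. c * d i) = (\<lambda>x. c * x) ` range d" by auto
  also have "Max \<dots> = c * Max (range d)"
    by (intro mono_Max_commute[symmetric]) (auto simp: mono_def intro: mult_left_mono assms)
  finally show ?thesis by (simp add: eigenbasis_lambda[OF E])
qed

lemma symmetric_matrix_simps:
  fixes X Y :: "real^'n^'n"
  shows "symmetric_matrix (mat c :: real^'n^'n)"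
    and "symmetric_matrix X \<Longrightarrow> symmetric_matrix Y \<Longrightarrow> symmetric_matrix (X + Y)"
    and "symmetric_matrix X \<Longrightarrow> symmetric_matrix Y \<Longrightarrow> symmetric_matrix (X - Y)"
    and "symmetric_matrix X \<Longrightarrow> symmetric_matrix (r *\<^sub>R X)"
  by (auto simp: symmetric_matrix_def transpose_def vec_eq_iff mat_def)

lemma psd_conjugate:
  fixes C Q :: "real^'n^'n"
  assumes C: "symmetric_matrix C" and Q: "psd Q"
  shows "psd (C ** Q ** C)"
proof -
  have "symmetric_matrix (C ** Q ** C)"
    using assms by (simp add: psd_def symmetric_matrix_def matrix_transpose_mul matrix_mul_assoc)
  moreover have "v \<bullet> ((C ** Q ** C) *v v) = (C *v v) \<bullet> (Q *v (C *v v))" for v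
    by (simp add: matrix_vector_mul_assoc[symmetric] symmetric_matrix_inner[OF C, of v])
  ultimately show ?thesis using Q by (simp add: psd_def)
qed

text \<open>
  Two factors at a time: \<open>P\<^sup>k\<^sup>+\<^sup>2 = P P\<^sup>k P\<close> is a conjugate of \<open>P\<^sup>k\<close>.
\<close>

lemma psd_pow:
  fixes P :: "real^'n^'n"
  assumes P: "psd P"
  shows "psd (matrix_pow P k)"
proof (induction k rule: induct_nat_012)
  case 0
  show ?case by (simp add: psd_def symmetric_matrix_simps)
next
  case 1
  show ?case using P by simp
next
  case (ge2 k)
  have "P ** matrix_pow P k = matrix_pow P k ** P" for k
    by (induction k) (simp_all, metis matrix_mul_assoc)
  then have "matrix_pow P (Suc (Suc k)) = P ** matrix_pow P k ** P"
    by (simp add: matrix_mul_assoc)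
  moreover have "symmetric_matrix P" using P by (simp add: psd_def)
  ultimately show ?case using psd_conjugate ge2(1) by metis
qed

text \<open>
  In an eigenbasis of \<open>Y\<close> the trace is a combination of values of the quadratic form of \<open>X\<close>,
  weighted with the nonnegative eigenvalues of \<open>Y\<close>.
\<close>

lemma trace_psd_mult_nonneg:
  fixes X Y :: "real^'n^'n"
  assumes X: "psd X" and Y: "psd Y"
  shows "0 \<le> trace (X ** Y)"
proof -
  obtain u d where E: "eigenbasis Y u d" using eigenbasis_exists Y unfolding psd_def by blast
  have "d i = u i \<bullet> (Y *v u i)" for i
    using E by (simp add: eigenbasis_def)
  then have "d i \<ge> 0" for i using Y by (simp add: psd_def)
  then show ?thesis
    using X by (auto simp: eigenbasis_trace[OF E] matrix_vector_mul_assoc[symmetric] eigenbasis_mult[OF E]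
        matrix_vector_mult_scaleR psd_def intro!: sum_nonneg mult_nonneg_nonneg)
qed

lemma trace_matrix_exp_bounds:
  fixes X :: "real^'n^'n"
  assumes "symmetric_matrix X"
  shows "exp (lambda_max X) \<le> trace (matrix_exp X)"
    and "trace (matrix_exp X) \<le> real CARD('n) * exp (lambda_max X)"
proof -
  obtain u d where E: "eigenbasis X u d" using eigenbasis_exists[OF assms] by blast
  have "Max (range d) \<in> range d" by (intro Max_in) auto
  then obtain i where "Max (range d) = d i" by (rule rangeE)
  then have i: "lambda_max X = d i" using eigenbasis_lambda[OF E] by simp
  have "exp (d i) \<le> (\<Sum>j\<in>UNIV. exp (d j))" by (intro member_le_sum) auto
  then show "exp (lambda_max X) \<le> trace (matrix_exp X)"
    by (simp add: trace_matrix_exp_eigenbasis(2)[OF E] i)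
  have "(\<Sum>j\<in>UNIV. exp (d j)) \<le> (\<Sum>j\<in>(UNIV::'n set). exp (lambda_max X))"
    by (intro sum_mono) (simp add: eigenbasis_lambda[OF E])
  then show "trace (matrix_exp X) \<le> real CARD('n) * exp (lambda_max X)"
    by (simp add: trace_matrix_exp_eigenbasis(2)[OF E])
qed

lemma trace_matrix_exp_shift:
  fixes X :: "real^'n^'n"
  assumes "symmetric_matrix X"
  shows "trace (matrix_exp (X + c *\<^sub>R mat 1)) = exp c * trace (matrix_exp X)"
proof -
  obtain u d where E: "eigenbasis X u d" using eigenbasis_exists[OF assms] by blast
  have "eigenbasis (X + c *\<^sub>R mat 1) u (\<lambda>i. d i + c)"
    using E by (simp add: eigenbasis_def matrix_vector_mult_add_rdistrib
        scaleR_matrix_vector_assoc[symmetric] scaleR_add_left)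
  then show ?thesis
    by (simp add: trace_matrix_exp_eigenbasis(2)[OF E] trace_matrix_exp_eigenbasis(2) exp_add
        sum_distrib_left mult.commute)
qed

lemma trace_scaleR: "trace (c *\<^sub>R X) = c * trace (X::real^'n^'n)"
  by (simp add: trace_def sum_distrib_left)

lemma trace_square_eigenbasis:
  fixes X :: "real^'n^'n"
  assumes E: "eigenbasis X u d"
  shows "trace ((X - c *\<^sub>R mat 1) ** (X - c *\<^sub>R mat 1)) = (\<Sum>i\<in>UNIV. (d i - c)\<^sup>2)"
proof -
  have "(X - c *\<^sub>R mat 1) *v u i = (d i - c) *\<^sub>R u i" for i
    by (simp add: matrix_vector_mult_diff_rdistrib scaleR_matrix_vector_assoc[symmetric]
        eigenbasis_mult[OF E] scaleR_left_diff_distrib)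
  then have "((X - c *\<^sub>R mat 1) ** (X - c *\<^sub>R mat 1)) *v u i = ((d i - c)\<^sup>2) *\<^sub>R u i" for i
    by (simp add: matrix_vector_mul_assoc[symmetric] matrix_vector_mult_scaleR power2_eq_square)
  then show ?thesis using E by (simp add: eigenbasis_trace[OF E] eigenbasis_def)
qed

text \<open>
  The sum of squared deviations of the eigenvalues is smallest around their mean.
\<close>

lemma trace_square_centered_le:
  fixes X :: "real^'n^'n"
  assumes "symmetric_matrix X"
  shows "trace (centered X ** centered X) \<le> trace ((X - c *\<^sub>R mat 1) ** (X - c *\<^sub>R mat 1))"
proof -
  obtain u d where E: "eigenbasis X u d" using eigenbasis_exists[OF assms] by blast
  define N where "N = real CARD('n)"
  define m where "m = trace X / N"
  have N: "N > 0" by (simp add: N_def)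
  have "trace X = (\<Sum>i\<in>UNIV. d i)"
    using E by (simp add: eigenbasis_trace[OF E] eigenbasis_def)
  then have sum0: "(\<Sum>i\<in>UNIV. d i - m) = 0"
    using N by (simp add: sum_subtractf m_def N_def)
  have "(d i - c)\<^sup>2 = (d i - m)\<^sup>2 + 2 * (m - c) * (d i - m) + (m - c)\<^sup>2" for i
    by (simp add: power2_eq_square algebra_simps)
  then have "(\<Sum>i\<in>UNIV. (d i - c)\<^sup>2)
      = (\<Sum>i\<in>UNIV. (d i - m)\<^sup>2) + 2 * (m - c) * (\<Sum>i\<in>UNIV. d i - m) + N * (m - c)\<^sup>2"
    by (simp add: sum.distrib sum_distrib_left N_def)
  then have "(\<Sum>i\<in>UNIV. (d i - m)\<^sup>2) \<le> (\<Sum>i\<in>UNIV. (d i - c)\<^sup>2)"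
    using sum0 N by simp
  then show ?thesis
    unfolding centered_def N_def[symmetric] m_def[symmetric] trace_square_eigenbasis[OF E] .
qed

text \<open>
  Two entries of a list of deviations satisfy \<open>(p - q)\<^sup>2 \<le> 2 (p\<^sup>2 + q\<^sup>2)\<close>, and \<open>p\<^sup>2 + q\<^sup>2\<close> is at most the sum
  of all squares.
\<close>

lemma eigenvalue_spread_le:
  fixes X :: "real^'n^'n"
  assumes "symmetric_matrix X"
  shows "lambda_max X - lambda_min X \<le> sqrt (2 * trace (centered X ** centered X))"
proof -
  obtain u d where E: "eigenbasis X u d" using eigenbasis_exists[OF assms] by blast
  define c where "c = trace X / real CARD('n)"
  have tr: "trace (centered X ** centered X) = (\<Sum>i\<in>UNIV. (d i - c)\<^sup>2)"
    unfolding centered_def c_def by (rule trace_square_eigenbasis[OF E])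
  have "Max (range d) \<in> range d" "Min (range d) \<in> range d" by (auto intro: Max_in Min_in)
  then obtain i j where "Max (range d) = d i" "Min (range d) = d j" by (blast elim!: rangeE)
  then have ij: "lambda_max X = d i" "lambda_min X = d j"
    using eigenbasis_lambda[OF E] by auto
  show ?thesis
  proof (cases "i = j")
    case True
    then show ?thesis using ij by (simp add: tr sum_nonneg)
  next
    case False
    have "(\<Sum>k\<in>{i,j}. (d k - c)\<^sup>2) \<le> (\<Sum>k\<in>UNIV. (d k - c)\<^sup>2)"
      by (intro sum_mono2) auto
    then have le: "(d i - c)\<^sup>2 + (d j - c)\<^sup>2 \<le> trace (centered X ** centered X)"
      using False by (simp add: tr)
    have "(d i - d j)\<^sup>2 \<le> 2 * ((d i - c)\<^sup>2 + (d j - c)\<^sup>2)"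
      using zero_le_power2[of "(d i - c) + (d j - c)"] by (simp add: power2_eq_square algebra_simps)
    also have "\<dots> \<le> 2 * trace (centered X ** centered X)"
      using le by (rule mult_left_mono) simp
    finally have "(d i - d j)\<^sup>2 \<le> 2 * trace (centered X ** centered X)" .
    then show ?thesis by (simp add: ij real_le_rsqrt)
  qed
qed

section \<open>Power series indexed by words\<close>

text \<open>
  A homogeneous polynomial whose coefficients are indexed by noncommutative monomials, that is,
  by words of length \<open>k\<close>.  The redundancy is deliberate: traces of matrix products depend on the
  order of the factors, and a derivative becomes an insertion of letters.
\<close>

primrec word_poly :: "nat \<Rightarrow> ('m::finite list \<Rightarrow> real) \<Rightarrow> real^'m \<Rightarrow> real" where
  "word_poly 0 c y = c []"
| "word_poly (Suc k) c y = (\<Sum>i\<in>UNIV. y $ i * word_poly k (\<lambda>w. c (i # w)) y)"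

definition word_series :: "('m::finite list \<Rightarrow> real) \<Rightarrow> real^'m \<Rightarrow> real" where
  "word_series c y = (\<Sum>k. word_poly k c y / fact k)"

text \<open>
  The sum of \<open>c\<close> over all words that arise from \<open>u\<close> by inserting the letter \<open>i\<close> at one of its
  \<open>length u + 1\<close> positions.
\<close>

primrec insert_sum :: "'m \<Rightarrow> ('m list \<Rightarrow> real) \<Rightarrow> 'm list \<Rightarrow> real" where
  "insert_sum i c [] = c [i]"
| "insert_sum i c (j # u) = c (i # j # u) + insert_sum i (\<lambda>w. c (j # w)) u"

text \<open>
  The average rather than the sum: the division turns the factor \<open>1 / (k + 1)!\<close> of the series
  into \<open>1 / k!\<close>, so that derivatives of word series are again word series.
\<close>

definition word_deriv :: "'m \<Rightarrow> ('m list \<Rightarrow> real) \<Rightarrow> 'm list \<Rightarrow> real" where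
  "word_deriv i c u = insert_sum i c u / real (Suc (length u))"

definition geometric_growth :: "('m list \<Rightarrow> real) \<Rightarrow> bool" where
  "geometric_growth c \<longleftrightarrow> (\<exists>K a. 0 \<le> K \<and> 0 \<le> a \<and> (\<forall>w. \<bar>c w\<bar> \<le> K * a ^ length w))"

lemma word_poly_add: "word_poly k (\<lambda>w. c w + c' w) y = word_poly k c y + word_poly k c' y"
  by (induction k arbitrary: c c') (simp_all add: sum.distrib distrib_left)

lemma word_poly_scale:
  assumes "\<And>w. length w = k \<Longrightarrow> c' w = r * c w"
  shows "word_poly k c' y = r * word_poly k c y"
  using assms
proof (induction k arbitrary: c c')
  case (Suc k)
  have "word_poly k (\<lambda>w. c' (i # w)) y = r * word_poly k (\<lambda>w. c (i # w)) y" for i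
    by (rule Suc.IH) (simp add: Suc.prems)
  then show ?case by (simp add: sum_distrib_left mult_ac)
qed simp

text \<open>
  The product rule for the leading variable of every word: either that variable is
  differentiated, which accounts for an insertion in front, or the remaining word is.
\<close>

lemma word_poly_has_derivative:
  "(word_poly (Suc k) c has_derivative (\<lambda>h. \<Sum>i\<in>UNIV. h $ i * word_poly k (insert_sum i c) y)) (at y)"
proof (induction k arbitrary: c)
  case 0
  show ?case
    unfolding word_poly.simps insert_sum.simps
    by (intro has_derivative_sum has_derivative_mult_left bounded_linear_imp_has_derivative bounded_linear_vec_nth)
next
  case (Suc k)
  have split: "word_poly (Suc k) (insert_sum i c) y
      = word_poly (Suc k) (\<lambda>u. c (i # u)) y + (\<Sum>j\<in>UNIV. y $ j * word_poly k (insert_sum i (\<lambda>w. c (j # w))) y)" for i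
    by (simp add: word_poly_add distrib_left sum.distrib)
  have "((\<lambda>y. \<Sum>j\<in>UNIV. y $ j * word_poly (Suc k) (\<lambda>w. c (j # w)) y) has_derivative
     (\<lambda>h. \<Sum>j\<in>UNIV. y $ j * (\<Sum>i\<in>UNIV. h $ i * word_poly k (insert_sum i (\<lambda>w. c (j # w))) y)
        + h $ j * word_poly (Suc k) (\<lambda>w. c (j # w)) y)) (at y)"
    by (intro has_derivative_sum has_derivative_mult Suc.IH bounded_linear_imp_has_derivative bounded_linear_vec_nth)
  moreover have "(\<Sum>j\<in>UNIV. y $ j * (\<Sum>i\<in>UNIV. h $ i * word_poly k (insert_sum i (\<lambda>w. c (j # w))) y)
        + h $ j * word_poly (Suc k) (\<lambda>w. c (j # w)) y)
      = (\<Sum>i\<in>UNIV. h $ i * word_poly (Suc k) (insert_sum i c) y)" for h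
  proof -
    have "(\<Sum>j\<in>UNIV. y $ j * (\<Sum>i\<in>UNIV. h $ i * word_poly k (insert_sum i (\<lambda>w. c (j # w))) y))
      = (\<Sum>i\<in>UNIV. \<Sum>j\<in>UNIV. h $ i * (y $ j * word_poly k (insert_sum i (\<lambda>w. c (j # w))) y))"
      unfolding sum_distrib_left by (subst sum.swap) (simp add: mult_ac)
    then show ?thesis
      unfolding split distrib_left sum.distrib sum_distrib_left[symmetric] by simp
  qed
  ultimately show ?case unfolding word_poly.simps(2)[of "Suc k" c] by simp
qed

lemma word_poly_bound:
  assumes "\<And>w. \<bar>c w\<bar> \<le> K * a ^ length w" and "0 \<le> K" "0 \<le> a"
    and "(\<Sum>i\<in>UNIV. \<bar>y $ i\<bar>) \<le> s"
  shows "\<bar>word_poly k c y\<bar> \<le> K * (a * s) ^ k"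
  using assms(1,2)
proof (induction k arbitrary: c K)
  case 0
  from 0(1)[of "[]"] show ?case by simp
next
  case (Suc k)
  have s: "0 \<le> s" using assms(4) by (meson abs_ge_zero order_trans sum_nonneg)
  have "\<bar>word_poly k (\<lambda>w. c (i # w)) y\<bar> \<le> (K * a) * (a * s) ^ k" for i
    using Suc.prems(1)[of "i # _"] Suc.prems(2) assms(3) by (intro Suc.IH) (auto simp: mult_ac)
  then have "\<bar>word_poly (Suc k) c y\<bar> \<le> (\<Sum>i\<in>UNIV. \<bar>y $ i\<bar> * ((K * a) * (a * s) ^ k))"
    by (auto simp: abs_mult intro!: order_trans[OF sum_abs] sum_mono mult_left_mono)
  also have "\<dots> \<le> s * ((K * a) * (a * s) ^ k)"
    unfolding sum_distrib_right[symmetric] using Suc.prems assms s by (intro mult_right_mono) auto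
  finally show ?case by (simp add: mult_ac)
qed

lemma insert_sum_bound:
  assumes "\<And>w. \<bar>c w\<bar> \<le> K * a ^ length w"
  shows "\<bar>insert_sum i c u\<bar> \<le> real (Suc (length u)) * (K * a ^ Suc (length u))"
  using assms
proof (induction u arbitrary: c K)
  case Nil
  from Nil[of "[i]"] show ?case by simp
next
  case (Cons j u)
  have "\<bar>insert_sum i (\<lambda>w. c (j # w)) u\<bar> \<le> real (Suc (length u)) * ((K * a) * a ^ Suc (length u))"
    using Cons.prems[of "j # _"] by (intro Cons.IH) (auto simp: mult_ac)
  moreover have "\<bar>c (i # j # u)\<bar> \<le> K * a ^ Suc (Suc (length u))" using Cons.prems[of "i # j # u"] by simp
  ultimately show ?case by (simp add: algebra_simps)
qed

lemma geometric_growth_word_deriv: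
  assumes "geometric_growth c"
  shows "geometric_growth (word_deriv i c)"
proof -
  obtain K a where K: "0 \<le> K" "0 \<le> a" "\<And>w. \<bar>c w\<bar> \<le> K * a ^ length w"
    using assms by (auto simp: geometric_growth_def)
  have "\<bar>word_deriv i c u\<bar> \<le> (K * a) * a ^ length u" for u
    using insert_sum_bound[of c K a i u] K
    by (simp add: word_deriv_def abs_divide divide_le_eq mult_ac del: of_nat_Suc)
  then show ?thesis unfolding geometric_growth_def using K by (intro exI[of _ "K * a"] exI[of _ a]) auto
qed

lemma word_series_term_bound:
  assumes "\<And>w. \<bar>c w\<bar> \<le> K * a ^ length w" and "0 \<le> K" "0 \<le> a"
    and "(\<Sum>i\<in>UNIV. \<bar>y $ i\<bar>) \<le> s"
  shows "\<bar>word_poly k c y / fact k\<bar> \<le> K * ((a * s) ^ k / fact k)"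
  using word_poly_bound[OF assms, of k] by (simp add: abs_divide divide_right_mono)

lemma summable_word_series:
  assumes "geometric_growth c"
  shows "summable (\<lambda>k. word_poly k c y / fact k)"
proof -
  obtain K a where K: "0 \<le> K" "0 \<le> a" "\<And>w. \<bar>c w\<bar> \<le> K * a ^ length w"
    using assms by (auto simp: geometric_growth_def)
  show ?thesis
  proof (rule summable_comparison_test')
    show "summable (\<lambda>k. K * ((a * (\<Sum>i\<in>UNIV. \<bar>y $ i\<bar>)) ^ k / fact k))"
      using summable_exp_generic[of "a * (\<Sum>i\<in>UNIV. \<bar>y $ i\<bar>)"]
      by (intro summable_mult) (simp add: divide_inverse mult.commute)
    show "norm (word_poly k c y / fact k) \<le> K * ((a * (\<Sum>i\<in>UNIV. \<bar>y $ i\<bar>)) ^ k / fact k)" if "k \<ge> 0" for k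
      using word_series_term_bound[OF K(3,1,2) order_refl] by simp
  qed
qed

lemma word_series_uniform_limit:
  assumes "geometric_growth c"
  shows "uniform_limit (ball 0 R) (\<lambda>n y. \<Sum>k<n. word_poly k c y / fact k) (word_series c) sequentially"
proof -
  obtain K a where K: "0 \<le> K" "0 \<le> a" "\<And>w. \<bar>c w\<bar> \<le> K * a ^ length w"
    using assms by (auto simp: geometric_growth_def)
  define s where "s = real CARD('a) * R"
  have s: "(\<Sum>i\<in>UNIV. \<bar>y $ i\<bar>) \<le> s" if "y \<in> ball 0 R" for y :: "real^'a"
  proof -
    have "(\<Sum>i\<in>UNIV. \<bar>y $ i\<bar>) \<le> (\<Sum>i\<in>(UNIV::'a set). R)"
      using that by (intro sum_mono) (use component_le_norm_cart[of y] in \<open>force intro: order_trans\<close>)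
    then show ?thesis by (simp add: s_def)
  qed
  show ?thesis unfolding word_series_def
  proof (rule Weierstrass_m_test)
    show "summable (\<lambda>k. K * ((a * s) ^ k / fact k))"
      using summable_exp_generic[of "a * s"]
      by (intro summable_mult) (simp add: divide_inverse mult.commute)
    show "norm (word_poly k c y / fact k) \<le> K * ((a * s) ^ k / fact k)" if "y \<in> ball 0 R" for k y
      using word_series_term_bound[OF K(3,1,2) s[OF that]] by simp
  qed
qed

text \<open>
  Termwise differentiation on a ball around the origin, where the series of the partial
  derivatives converge uniformly by the geometric growth of their coefficients.
\<close>

theorem word_series_has_derivative:
  assumes c: "geometric_growth c"
  shows "(word_series c has_derivative (\<lambda>h. \<Sum>i\<in>UNIV. h $ i * word_series (word_deriv i c) y)) (at y)"
proof -
  define S where "S = ball (0::real^'a) (norm y + 1)"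
  define g' where "g' = (\<lambda>y (h::real^'a). \<Sum>i\<in>UNIV. h $ i * word_series (word_deriv i c) y)"
  define f' where "f' = (\<lambda>k y (h::real^'a). \<Sum>i\<in>UNIV. h $ i * (word_poly k (word_deriv i c) y / fact k))"
  have f': "((\<lambda>y. word_poly (Suc k) c y / fact (Suc k)) has_derivative f' k x) (at x within S)" for k x
  proof -
    have "word_poly k (insert_sum i c) x / fact (Suc k) = word_poly k (word_deriv i c) x / fact k" for i
    proof -
      have "word_poly k (insert_sum i c) x = real (Suc k) * word_poly k (word_deriv i c) x"
        by (rule word_poly_scale) (simp add: word_deriv_def field_simps del: of_nat_Suc)
      then show ?thesis by (simp add: fact_Suc del: of_nat_Suc)
    qed
    then have "f' k x = (\<lambda>h. (\<Sum>i\<in>UNIV. h $ i * word_poly k (insert_sum i c) x) / fact (Suc k))"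
      unfolding f'_def sum_divide_distrib times_divide_eq_right[symmetric] by simp
    then show ?thesis
      using has_derivative_at_withinI[OF word_poly_has_derivative[of k c x]]
      by (simp only: divide_inverse) (rule has_derivative_mult_left)
  qed
  have lim: "\<forall>\<^sub>F n in sequentially. \<forall>x\<in>S. \<forall>h. norm (sum (\<lambda>k. f' k x h) {..<n} - g' x h) \<le> e * norm h"
    if e: "e > 0" for e
  proof -
    define e' where "e' = e / real CARD('a)"
    have e': "e' > 0" using e by (simp add: e'_def)
    have "\<forall>\<^sub>F n in sequentially. \<forall>i\<in>(UNIV::'a set). \<forall>x\<in>S.
        dist (\<Sum>k<n. word_poly k (word_deriv i c) x / fact k) (word_series (word_deriv i c) x) < e'"
      using word_series_uniform_limit[OF geometric_growth_word_deriv[OF c]] e'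
      unfolding uniform_limit_iff S_def by (intro eventually_ball_finite) auto
    then show ?thesis
    proof (eventually_elim, intro ballI allI)
      fix n x and h :: "real^'a"
      assume H: "\<forall>i\<in>(UNIV::'a set). \<forall>x\<in>S.
        dist (\<Sum>k<n. word_poly k (word_deriv i c) x / fact k) (word_series (word_deriv i c) x) < e'" and x: "x \<in> S"
      have "sum (\<lambda>k. f' k x h) {..<n} - g' x h
          = (\<Sum>i\<in>UNIV. h $ i * ((\<Sum>k<n. word_poly k (word_deriv i c) x / fact k) - word_series (word_deriv i c) x))"
        unfolding f'_def g'_def by (subst sum.swap) (simp add: sum_distrib_left right_diff_distrib sum_subtractf)
      also have "norm \<dots> \<le> (\<Sum>i\<in>(UNIV::'a set). norm h * e')"
        using H x unfolding dist_real_def real_norm_def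
        by (intro order_trans[OF sum_abs] sum_mono) (simp add: abs_mult, intro mult_mono, auto intro: component_le_norm_cart less_imp_le)
      also have "\<dots> = e * norm h" by (simp add: e'_def)
      finally show "norm (sum (\<lambda>k. f' k x h) {..<n} - g' x h) \<le> e * norm h" .
    qed
  qed
  \<comment> \<open>The constant term is split off, as the \<open>k\<close>-th term of the derivative stems from the polynomial
    of degree \<open>k + 1\<close>.\<close>
  have shift: "(\<lambda>k. word_poly (Suc k) c x / fact (Suc k)) sums (word_series c x - c [])" for x
    using summable_word_series[OF c, of x] unfolding word_series_def
    by (subst sums_Suc_iff) (simp add: summable_sums)
  have yS: "y \<in> S" by (simp add: S_def)
  have "convex S" by (simp add: S_def)
  then have "\<exists>g. \<forall>x\<in>S. (\<lambda>k. word_poly (Suc k) c x / fact (Suc k)) sums g x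
      \<and> (g has_derivative g' x) (at x within S)"
    by (rule has_derivative_series[OF _ f' lim yS shift])
  then obtain g where g0: "\<forall>x\<in>S. (\<lambda>k. word_poly (Suc k) c x / fact (Suc k)) sums g x
      \<and> (g has_derivative g' x) (at x within S)" ..
  have g: "(\<lambda>k. word_poly (Suc k) c x / fact (Suc k)) sums g x" if "x \<in> S" for x
    using bspec[OF g0 that] by (rule conjunct1)
  have "(g has_derivative g' y) (at y within S)"
    using bspec[OF g0 yS] by (rule conjunct2)
  moreover have "at y within S = at y" by (intro at_within_open yS) (simp add: S_def)
  ultimately have "((\<lambda>x. g x + c []) has_derivative g' y) (at y)"
    by (simp add: has_derivative_add_const)
  then have "(word_series c has_derivative g' y) (at y)"
  proof (rule has_derivative_transform_within_open)
    show "open S" "y \<in> S" by (auto simp: S_def)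
    show "g x + c [] = word_series c x" if "x \<in> S" for x
      using sums_unique2[OF g[OF that] shift] by simp
  qed
  then show ?thesis by (simp add: g'_def)
qed

lemma insert_sum_scale:
  assumes "\<And>w. length w = Suc (length u) \<Longrightarrow> c' w = r * c w"
  shows "insert_sum i c' u = r * insert_sum i c u"
  using assms
proof (induction u arbitrary: c c')
  case (Cons j u)
  have "insert_sum i (\<lambda>w. c' (j # w)) u = r * insert_sum i (\<lambda>w. c (j # w)) u"
    by (rule Cons.IH) (simp add: Cons.prems)
  then show ?case by (simp add: Cons.prems distrib_left)
qed simp

lemma insert_sum_add: "insert_sum i (\<lambda>w. c w + c' w) u = insert_sum i c u + insert_sum i c' u"
  by (induction u arbitrary: c c') simp_all

lemma insert_sum_commute: "insert_sum i (insert_sum j c) u = insert_sum j (insert_sum i c) u"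
  by (induction u arbitrary: c) (simp_all add: insert_sum_add)

text \<open>
  Inserting two letters one after the other gives the same words in either order.  This is the
  symmetry of second derivatives for word series.
\<close>

lemma word_deriv_commute: "word_deriv i (word_deriv j c) = word_deriv j (word_deriv i c)"
proof
  fix u
  have "insert_sum i (word_deriv j c) u = (1 / real (Suc (Suc (length u)))) * insert_sum i (insert_sum j c) u" for i j
    by (rule insert_sum_scale) (simp add: word_deriv_def)
  then show "word_deriv i (word_deriv j c) u = word_deriv j (word_deriv i c) u"
    unfolding word_deriv_def[of _ "word_deriv _ _"] by (simp add: insert_sum_commute[of i j])
qed

section \<open>Iterated partial derivatives\<close>

lemma partial_deriv_eq:
  assumes "(f has_derivative f') (at y)"
  shows "partial_deriv i f y = f' (axis i 1)"
  using frechet_derivative_at[OF assms] by (simp add: partial_deriv_def)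

lemma has_derivative_partial_derivs:
  fixes f :: "real^'m::finite \<Rightarrow> real"
  assumes "f differentiable (at y)"
  shows "(f has_derivative (\<lambda>h. \<Sum>i\<in>UNIV. h $ i * partial_deriv i f y)) (at y)"
proof -
  let ?D = "frechet_derivative f (at y)"
  have D: "(f has_derivative ?D) (at y)" using assms frechet_derivative_works by blast
  then have lin: "linear ?D" by (rule has_derivative_linear)
  have "?D h = (\<Sum>i\<in>UNIV. h $ i * partial_deriv i f y)" for h
  proof -
    have "?D h = ?D (\<Sum>i\<in>UNIV. h $ i *\<^sub>R axis i 1)"
      by (simp add: basis_expansion scalar_mult_eq_scaleR[symmetric])
    then show ?thesis by (simp add: linear_sum[OF lin] linear_cmul[OF lin] partial_deriv_def)
  qed
  then have "?D = (\<lambda>h. \<Sum>i\<in>UNIV. h $ i * partial_deriv i f y)" by blast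
  then show ?thesis using D by simp
qed

lemma cont_diff_SucD: "cont_diff (Suc k) f \<Longrightarrow> cont_diff k f"
proof (induction k arbitrary: f)
  case 0
  then show ?case by (simp add: differentiable_imp_continuous_on)
next
  case (Suc k)
  then show ?case by auto
qed

text \<open>
  The closure properties below rest on this rule: it exposes the partial derivatives
  as explicit functions, to which the induction hypothesis applies.
\<close>

lemma cont_diff_SucI:
  assumes "\<And>y. (f has_derivative f' y) (at y)"
    and "\<And>i. cont_diff k (\<lambda>y. f' y (axis i 1))"
  shows "cont_diff (Suc k) f"
proof -
  have "partial_deriv i f = (\<lambda>y. f' y (axis i 1))" for i
    using partial_deriv_eq[OF assms(1)] by auto
  moreover have "f differentiable_on UNIV"
    using assms(1) by (auto simp: differentiable_on_def differentiable_def)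
  ultimately show ?thesis using assms(2) by simp
qed

lemma cont_diff_Suc_has_derivative:
  assumes "cont_diff (Suc k) f"
  shows "(f has_derivative (\<lambda>h. \<Sum>i\<in>UNIV. h $ i * partial_deriv i f y)) (at y)"
  using assms by (intro has_derivative_partial_derivs) (auto simp: differentiable_on_def)

lemma sum_axis_mult: "(\<Sum>j\<in>UNIV. axis i (1::real) $ j * g j) = g i"
  by (simp add: axis_def if_distrib[of "\<lambda>x. x * _"] cong: if_cong)

lemma cont_diff_const: "cont_diff k (\<lambda>y. c)"
proof (induction k arbitrary: c)
  case (Suc k)
  show ?case by (rule cont_diff_SucI[where f'="\<lambda>_ _. 0"]) (auto intro: Suc)
qed simp

lemma cont_diff_inner: "cont_diff k (\<lambda>y. b \<bullet> y)"
proof (cases k)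
  case (Suc k')
  show ?thesis unfolding Suc
    by (rule cont_diff_SucI[where f'="\<lambda>_ h. b \<bullet> h"]) (auto intro!: derivative_eq_intros cont_diff_const)
qed (auto intro!: continuous_intros)

lemma cont_diff_diff:
  "cont_diff k f \<Longrightarrow> cont_diff k g \<Longrightarrow> cont_diff k (\<lambda>y. f y - g y)"
proof (induction k arbitrary: f g)
  case 0
  then show ?case by (simp add: continuous_on_diff)
next
  case (Suc k)
  show ?case
  proof (rule cont_diff_SucI)
    show "((\<lambda>y. f y - g y) has_derivative (\<lambda>h. (\<Sum>i\<in>UNIV. h $ i * partial_deriv i f y) - (\<Sum>i\<in>UNIV. h $ i * partial_deriv i g y))) (at y)" for y
      by (intro has_derivative_diff cont_diff_Suc_has_derivative[OF Suc.prems(1)] cont_diff_Suc_has_derivative[OF Suc.prems(2)])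
    show "cont_diff k (\<lambda>y. (\<Sum>j\<in>UNIV. axis i 1 $ j * partial_deriv j f y) - (\<Sum>j\<in>UNIV. axis i 1 $ j * partial_deriv j g y))" for i
      using Suc by (auto simp: sum_axis_mult)
  qed
qed

lemma cont_diff_add:
  "cont_diff k f \<Longrightarrow> cont_diff k g \<Longrightarrow> cont_diff k (\<lambda>y. f y + g y)"
  using cont_diff_diff[OF _ cont_diff_diff[OF cont_diff_const[of k 0]], of f g] by simp

lemma cont_diff_mult:
  "cont_diff k f \<Longrightarrow> cont_diff k g \<Longrightarrow> cont_diff k (\<lambda>y. f y * g y)"
proof (induction k arbitrary: f g)
  case 0
  then show ?case by (simp add: continuous_on_mult)
next
  case (Suc k)
  show ?case
  proof (rule cont_diff_SucI)
    show "((\<lambda>y. f y * g y) has_derivative (\<lambda>h. f y * (\<Sum>i\<in>UNIV. h $ i * partial_deriv i g y) + (\<Sum>i\<in>UNIV. h $ i * partial_deriv i f y) * g y)) (at y)" for y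
      by (intro has_derivative_mult cont_diff_Suc_has_derivative[OF Suc.prems(1)] cont_diff_Suc_has_derivative[OF Suc.prems(2)])
    show "cont_diff k (\<lambda>y. f y * (\<Sum>j\<in>UNIV. axis i 1 $ j * partial_deriv j g y) + (\<Sum>j\<in>UNIV. axis i 1 $ j * partial_deriv j f y) * g y)" for i
      unfolding sum_axis_mult
      using Suc.prems cont_diff_SucD[OF Suc.prems(1)] cont_diff_SucD[OF Suc.prems(2)]
      by (intro cont_diff_add Suc.IH) auto
  qed
qed

lemma cont_diff_inverse:
  "cont_diff k g \<Longrightarrow> (\<And>y. g y \<noteq> 0) \<Longrightarrow> cont_diff k (\<lambda>y. inverse (g y))"
proof (induction k)
  case 0
  then show ?case by (simp add: continuous_on_inverse)
next
  case (Suc k)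
  show ?case
  proof (rule cont_diff_SucI)
    show "((\<lambda>y. inverse (g y)) has_derivative (\<lambda>h. - (inverse (g y) * (\<Sum>i\<in>UNIV. h $ i * partial_deriv i g y) * inverse (g y)))) (at y)" for y
      by (intro Deriv.has_derivative_inverse Suc.prems(2) cont_diff_Suc_has_derivative[OF Suc.prems(1)])
    have I: "cont_diff k (\<lambda>y. inverse (g y))" by (rule Suc.IH[OF cont_diff_SucD[OF Suc.prems(1)] Suc.prems(2)])
    have "cont_diff k (\<lambda>y. 0 - inverse (g y) * partial_deriv i g y * inverse (g y))" for i
      using Suc.prems I by (intro cont_diff_mult cont_diff_diff cont_diff_const) auto
    then show "cont_diff k (\<lambda>y. - (inverse (g y) * (\<Sum>j\<in>UNIV. axis i 1 $ j * partial_deriv j g y) * inverse (g y)))" for i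
      unfolding sum_axis_mult by simp
  qed
qed

lemma cont_diff_ln:
  assumes "cont_diff k g" and "\<And>y. g y > 0"
  shows "cont_diff k (\<lambda>y. ln (g y))"
proof (cases k)
  case 0
  then show ?thesis using assms by (auto intro!: continuous_on_ln simp: less_imp_neq[symmetric])
next
  case (Suc k')
  have c: "cont_diff (Suc k') g" using assms Suc by simp
  have nz: "g y \<noteq> 0" for y using assms(2)[of y] by simp
  show ?thesis unfolding Suc
  proof (rule cont_diff_SucI)
    show "((\<lambda>y. ln (g y)) has_derivative (\<lambda>h. inverse (g y) * (\<Sum>i\<in>UNIV. h $ i * partial_deriv i g y))) (at y)" for y
      using has_derivative_ln[OF assms(2) cont_diff_Suc_has_derivative[OF c]] by (simp add: divide_inverse mult.commute)
    show "cont_diff k' (\<lambda>y. inverse (g y) * (\<Sum>j\<in>UNIV. axis i 1 $ j * partial_deriv j g y))" for i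
      unfolding sum_axis_mult
      using c cont_diff_SucD[OF c] nz by (intro cont_diff_mult cont_diff_inverse) auto
  qed
qed

lemma partial_deriv_word_series:
  assumes "geometric_growth c"
  shows "partial_deriv i (word_series c) = word_series (word_deriv i c)"
  using partial_deriv_eq[OF word_series_has_derivative[OF assms]] by (auto simp: sum_axis_mult)

lemma cont_diff_word_series:
  assumes "geometric_growth c"
  shows "cont_diff k (word_series c)"
  using assms
proof (induction k arbitrary: c)
  case 0
  then show ?case
    by (auto intro!: continuous_at_imp_continuous_on has_derivative_continuous[OF word_series_has_derivative])
next
  case (Suc k)
  show ?case
    by (rule cont_diff_SucI[OF word_series_has_derivative[OF Suc.prems]])
       (simp add: sum_axis_mult Suc.IH geometric_growth_word_deriv Suc.prems)
qed

lemma directional_derivative: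
  fixes f :: "real^'m::finite \<Rightarrow> real"
  assumes "cont_diff (Suc k) f"
  shows "((\<lambda>t. f (y + t *\<^sub>R v)) has_real_derivative (\<Sum>i\<in>UNIV. v $ i * partial_deriv i f (y + t *\<^sub>R v))) (at t)"
proof -
  have "((\<lambda>t. y + t *\<^sub>R v) has_derivative (\<lambda>h. h *\<^sub>R v)) (at t)"
    by (auto intro!: derivative_eq_intros)
  from has_derivative_compose[OF this cont_diff_Suc_has_derivative[OF assms]]
  show ?thesis
    by (rule has_derivative_imp_has_field_derivative) (simp add: sum_distrib_left mult_ac)
qed

text \<open>
  Connects the Hessian, an array of iterated partial derivatives, with one-variable calculus
  along lines, in which all estimates are made.
\<close>

lemma second_directional_derivative:
  fixes f :: "real^'m::finite \<Rightarrow> real"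
  assumes "cont_diff 2 f"
  shows "((\<lambda>t. \<Sum>i\<in>UNIV. v $ i * partial_deriv i f (y + t *\<^sub>R v)) has_real_derivative
     v \<bullet> (hessian f (y + t *\<^sub>R v) *v v)) (at t)"
proof -
  have c: "cont_diff (Suc 0) (partial_deriv i f)" for i
    using assms by (simp add: numeral_2_eq_2)
  have "((\<lambda>t. \<Sum>i\<in>UNIV. v $ i * partial_deriv i f (y + t *\<^sub>R v)) has_real_derivative
     (\<Sum>i\<in>UNIV. v $ i * (\<Sum>j\<in>UNIV. v $ j * partial_deriv j (partial_deriv i f) (y + t *\<^sub>R v)))) (at t)"
    by (intro DERIV_sum DERIV_cmult directional_derivative[OF c])
  moreover have "(\<Sum>i\<in>UNIV. v $ i * (\<Sum>j\<in>UNIV. v $ j * partial_deriv j (partial_deriv i f) (y + t *\<^sub>R v)))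
      = v \<bullet> (hessian f (y + t *\<^sub>R v) *v v)"
    unfolding inner_vec_def hessian_def matrix_vector_mult_def sum_distrib_left
    by (subst sum.swap) (simp add: mult_ac sum_distrib_left)
  ultimately show ?thesis by simp
qed

section \<open>The trace of the matrix exponential as a word series\<close>

definition word_prod :: "('a \<Rightarrow> real^'n^'n) \<Rightarrow> 'a list \<Rightarrow> real^'n^'n" where
  "word_prod F w = foldr (\<lambda>i M. F i ** M) w (mat 1)"

lemma word_prod_simps [simp]:
  "word_prod F [] = mat 1" "word_prod F (i # w) = F i ** word_prod F w"
  by (simp_all add: word_prod_def)

lemma word_prod_append: "word_prod F (u @ w) = word_prod F u ** word_prod F w"
  by (induction u) (simp_all add: matrix_mul_assoc)

lemma word_prod_replicate: "word_prod F (replicate k i) = matrix_pow (F i) k"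
  by (induction k) simp_all

lemma matrix_pow_add: "matrix_pow P (j + k) = matrix_pow P j ** matrix_pow P k"
  by (induction j) (simp_all add: matrix_mul_assoc)

lemma geometric_growth_trace_word_prod:
  fixes F :: "'a::finite \<Rightarrow> real^'n^'n"
  shows "geometric_growth (\<lambda>w. trace (word_prod F w))"
proof -
  define a where "a = (\<Sum>i\<in>UNIV. norm (F i))"
  define N where "N = real CARD('n)"
  have a: "\<bar>F i $ p $ q\<bar> \<le> a" for i p q
  proof -
    have "\<bar>F i $ p $ q\<bar> \<le> norm (F i $ p)" by (rule component_le_norm_cart)
    also have "\<dots> \<le> norm (F i)" by (rule Finite_Cartesian_Product.norm_nth_le)
    also have "\<dots> \<le> a" unfolding a_def by (intro member_le_sum) auto
    finally show ?thesis .
  qed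
  have a0: "0 \<le> a" by (simp add: a_def sum_nonneg)
  have entry: "\<bar>word_prod F w $ p $ q\<bar> \<le> (N * a) ^ length w" for w p q
  proof (induction w arbitrary: p)
    case (Cons i w)
    have "\<bar>word_prod F (i # w) $ p $ q\<bar> \<le> (\<Sum>r\<in>UNIV. \<bar>F i $ p $ r * word_prod F w $ r $ q\<bar>)"
      by (simp add: matrix_matrix_mult_def)
    also have "\<dots> \<le> (\<Sum>r\<in>(UNIV::'n set). a * (N * a) ^ length w)"
      unfolding abs_mult using a a0 Cons by (intro sum_mono mult_mono) auto
    finally have "\<bar>word_prod F (i # w) $ p $ q\<bar> \<le> (\<Sum>r\<in>(UNIV::'n set). a * (N * a) ^ length w)" .
    then show ?case by (simp add: N_def mult_ac)
  qed (simp add: mat_def)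
  have "\<bar>trace (word_prod F w)\<bar> \<le> (\<Sum>p\<in>(UNIV::'n set). (N * a) ^ length w)" for w
    unfolding trace_def by (intro order_trans[OF sum_abs] sum_mono entry)
  then have "\<bar>trace (word_prod F w)\<bar> \<le> N * (N * a) ^ length w" for w by (simp add: N_def)
  then show ?thesis unfolding geometric_growth_def using a0
    by (intro exI[of _ N] exI[of _ "N * a"]) (auto simp: N_def)
qed

text \<open>
  The prefix \<open>M\<close> collects the factors already expanded, which makes the induction on the power
  go through.
\<close>

lemma trace_pow_matrix_pencil:
  fixes F :: "'a::finite \<Rightarrow> real^'n^'n"
  shows "trace (M ** matrix_pow (matrix_pencil F y) k) = word_poly k (\<lambda>w. trace (M ** word_prod F w)) y"
proof (induction k arbitrary: M)
  case (Suc k)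
  let ?N = "matrix_pow (matrix_pencil F y) k"
  have lin: "linear (\<lambda>X. trace (M ** X ** ?N))"
    by (intro linearI)
      (simp_all add: trace_def matrix_matrix_mult_def sum_distrib_left sum_distrib_right
        distrib_left distrib_right sum.distrib mult_ac)
  have "trace (M ** matrix_pow (matrix_pencil F y) (Suc k)) = trace (M ** matrix_pencil F y ** ?N)"
    by (simp add: matrix_mul_assoc)
  also have "\<dots> = (\<Sum>i\<in>UNIV. y $ i * trace (M ** F i ** ?N))"
    unfolding matrix_pencil_def[of F y, THEN arg_cong[of _ _ "\<lambda>X. trace (M ** X ** ?N)"]]
    by (simp add: linear_sum[OF lin] linear_cmul[OF lin])
  also have "\<dots> = word_poly (Suc k) (\<lambda>w. trace (M ** word_prod F w)) y"
    by (simp add: Suc.IH matrix_mul_assoc)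
  finally show ?case .
qed simp

lemma symmetric_matrix_pencil:
  assumes "\<And>i. symmetric_matrix (F i)"
  shows "symmetric_matrix (matrix_pencil F y)"
  using assms by (simp add: symmetric_matrix_def matrix_pencil_def transpose_def vec_eq_iff)

lemma trace_exp_matrix_pencil:
  fixes F :: "'a::finite \<Rightarrow> real^'n^'n"
  assumes "\<And>i. symmetric_matrix (F i)"
  shows "trace (matrix_exp (matrix_pencil F y)) = word_series (\<lambda>w. trace (word_prod F w)) y"
proof -
  obtain u d where E: "eigenbasis (matrix_pencil F y) u d"
    using eigenbasis_exists[OF symmetric_matrix_pencil[of F y, OF assms]] by blast
  have "trace (matrix_pow (matrix_pencil F y) k) = word_poly k (\<lambda>w. trace (word_prod F w)) y" for k
    using trace_pow_matrix_pencil[of "mat 1" F y k] by simp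
  then show ?thesis
    using trace_matrix_exp_eigenbasis(1)[OF E] unfolding word_series_def by (simp add: sums_iff)
qed

text \<open>
  On a coordinate axis only the words that repeat a single letter survive.
\<close>

lemma word_poly_axis: "word_poly k c (axis l 1) = c (replicate k l)"
  by (induction k arbitrary: c) (simp_all add: sum_axis_mult)

section \<open>Second-order perturbation of the trace of the exponential\<close>

text \<open>
  Each derivative in the direction of a letter lowers by one the number of its occurrences on
  which nonnegativity has to be known.  Two applications turn a hypothesis on words with two
  occurrences into a conclusion on words with none.
\<close>

lemma insert_sum_nonneg:
  assumes "\<And>w. count_list w i = Suc j \<Longrightarrow> 0 \<le> c w" and "count_list u i = j"
  shows "0 \<le> insert_sum i c u"
  using assms
proof (induction u arbitrary: c j)
  case (Cons l u)
  have "0 \<le> insert_sum i (\<lambda>w. c (l # w)) u"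
    using Cons.prems by (intro Cons.IH[of "count_list u i"]) auto
  moreover have "0 \<le> c (i # l # u)" using Cons.prems by auto
  ultimately show ?case by simp
qed simp

lemma word_deriv_nonneg:
  assumes "\<And>w. count_list w i = Suc j \<Longrightarrow> 0 \<le> c w" and "count_list u i = j"
  shows "0 \<le> word_deriv i c u"
  using insert_sum_nonneg[OF assms] by (simp add: word_deriv_def)

lemma bool_word_split:
  "count_list w True = Suc j \<Longrightarrow> \<exists>a w'. w = replicate a False @ True # w' \<and> count_list w' True = j"
proof (induction w)
  case (Cons l w)
  show ?case
  proof (cases l)
    case True
    then show ?thesis using Cons.prems by (intro exI[of _ 0] exI[of _ w]) simp
  next
    case False
    then obtain a w' where "w = replicate a False @ True # w'" "count_list w' True = j"
      using Cons by auto
    then show ?thesis using False by (intro exI[of _ "Suc a"] exI[of _ w']) simp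
  qed
qed simp

lemma bool_word_replicate: "count_list w True = 0 \<Longrightarrow> w = replicate (length w) False"
  by (induction w) (auto split: if_splits)

text \<open>
  The word series over the two letters \<open>P\<close> (\<open>False\<close>) and \<open>C\<close> (\<open>True\<close>), restricted to the line on which
  the letter \<open>P\<close> has coefficient \<open>1\<close>.  The second derivative at the origin is a sum of averages of
  traces of words with exactly two letters \<open>C\<close>, all of them nonnegative, and the word \<open>C C\<close> alone
  contributes \<open>tr (C\<^sup>2)\<close>.
\<close>

lemma trace_exp_perturbation:
  fixes P C :: "real^'n^'n"
  assumes P: "psd P" and C: "symmetric_matrix C"
  obtains \<psi>' \<psi>'' where
    "\<And>t. ((\<lambda>t. trace (matrix_exp (P + t *\<^sub>R C))) has_real_derivative \<psi>' t) (at t)"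
    "(\<psi>' has_real_derivative \<psi>'') (at 0)" "trace (C ** C) \<le> \<psi>''"
proof -
  define F where "F = (\<lambda>l. if l then C else P)"
  define c where "c = (\<lambda>w. trace (word_prod F w))"
  define z where "z = (\<lambda>t. axis False 1 + t *\<^sub>R axis True (1::real))"
  have Fsym: "symmetric_matrix (F l)" for l using P C by (simp add: F_def psd_def)
  have gc: "geometric_growth c" unfolding c_def by (rule geometric_growth_trace_word_prod)
  have pencil: "matrix_pencil F (z t) = P + t *\<^sub>R C" for t
    by (simp add: matrix_pencil_def UNIV_bool F_def z_def axis_def)
  have psi: "trace (matrix_exp (P + t *\<^sub>R C)) = word_series c (z t)" for t
    using trace_exp_matrix_pencil[of F "z t", OF Fsym] by (simp add: pencil c_def)
  have D: "((\<lambda>t. word_series e (z t)) has_real_derivative word_series (word_deriv True e) (z t)) (at t)"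
    if e: "geometric_growth e" for e t
    using directional_derivative[OF cont_diff_word_series[OF e], of "axis False 1" "axis True 1" t]
    by (simp add: z_def sum_axis_mult partial_deriv_word_series[OF e])
  define c'' where "c'' = word_deriv True (word_deriv True c)"
  have gc'': "geometric_growth c''" unfolding c''_def by (intro geometric_growth_word_deriv gc)
  \<comment> \<open>Such a word reads \<open>P\<^sup>i C P\<^sup>j C P\<^sup>k\<close>, and by cyclic rotation its trace is that of \<open>C P\<^sup>j C\<close> times
    \<open>P\<^sup>k\<^sup>+\<^sup>i\<close>, a product of positive semidefinite matrices.\<close>
  have two: "0 \<le> c w" if w: "count_list w True = Suc (Suc 0)" for w
  proof -
    obtain i w' where w': "w = replicate i False @ True # w'" "count_list w' True = Suc 0"
      using bool_word_split[OF w] by blast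
    obtain j w'' where w'': "w' = replicate j False @ True # w''" "count_list w'' True = 0"
      using bool_word_split[OF w'(2)] by blast
    define k where "k = length w''"
    have "w'' = replicate k False" using bool_word_replicate[OF w''(2)] by (simp add: k_def)
    then have "word_prod F w = matrix_pow P i ** (C ** matrix_pow P j ** C ** matrix_pow P k)"
      by (simp add: w' w'' word_prod_append word_prod_replicate matrix_mul_assoc) (simp add: F_def)
    then have "c w = trace ((C ** matrix_pow P j ** C ** matrix_pow P k) ** matrix_pow P i)"
      unfolding c_def by (metis trace_mul_sym)
    also have "\<dots> = trace ((C ** matrix_pow P j ** C) ** matrix_pow P (k + i))"
      by (simp add: matrix_pow_add matrix_mul_assoc)
    also have "\<dots> \<ge> 0" by (intro trace_psd_mult_nonneg psd_conjugate psd_pow P C)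
    finally show ?thesis .
  qed
  have nonneg: "0 \<le> c'' (replicate k False)" for k
    unfolding c''_def
    by (rule word_deriv_nonneg[of _ 0], rule word_deriv_nonneg[of _ "Suc 0"]) (auto intro: two)
  have "c'' [] = trace (C ** C)" by (simp add: c''_def word_deriv_def c_def F_def)
  moreover have "(\<Sum>k<Suc 0. c'' (replicate k False) / fact k) \<le> (\<Sum>k. c'' (replicate k False) / fact k)"
    using summable_word_series[OF gc'', of "axis False 1"] nonneg
    by (intro sum_le_suminf) (auto simp: word_poly_axis)
  ultimately have "trace (C ** C) \<le> word_series c'' (z 0)"
    by (simp add: z_def word_series_def word_poly_axis)
  then show ?thesis
    using that[of "\<lambda>t. word_series (word_deriv True c) (z t)" "word_series c'' (z 0)"]
      D[OF gc] D[OF geometric_growth_word_deriv[OF gc]] by (simp add: psi c''_def)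
qed

section \<open>The log-partition function and its Hessian\<close>

lemma log_partition_word_series:
  assumes "\<And>i. symmetric_matrix (A i)"
  shows "log_partition A b = (\<lambda>y. ln (word_series (\<lambda>w. trace (word_prod A w)) y) - b \<bullet> y)"
  by (rule ext) (simp add: log_partition_def trace_exp_matrix_pencil[of A, OF assms])

lemma trace_matrix_exp_pos:
  fixes X :: "real^'n^'n"
  assumes "symmetric_matrix X"
  shows "0 < trace (matrix_exp X)"
  using trace_matrix_exp_bounds(1)[OF assms] exp_gt_zero[of "lambda_max X"] by linarith

lemma word_series_trace_pos:
  assumes "\<And>i. symmetric_matrix (A i)"
  shows "0 < word_series (\<lambda>w. trace (word_prod A w)) y"
  using trace_matrix_exp_pos[OF symmetric_matrix_pencil[of A y, OF assms]]
  by (simp add: trace_exp_matrix_pencil[of A, OF assms])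

lemma smooth_log_partition:
  assumes "\<And>i. symmetric_matrix (A i)"
  shows "smooth (log_partition A b)"
  unfolding smooth_def log_partition_word_series[of A, OF assms]
  by (intro allI cont_diff_diff cont_diff_ln cont_diff_word_series cont_diff_inner
      geometric_growth_trace_word_prod word_series_trace_pos assms)

lemma symmetric_hessian_log_partition:
  assumes A: "\<And>i. symmetric_matrix (A i)"
  shows "symmetric_matrix (hessian (log_partition A b) y)"
proof -
  define c where "c = (\<lambda>w. trace (word_prod A w))"
  define Z where "Z = word_series c"
  define g where "g = (\<lambda>i. word_series (word_deriv i c))"
  have gc: "geometric_growth c" unfolding c_def by (rule geometric_growth_trace_word_prod)
  have Z: "Z y > 0" for y using word_series_trace_pos[of A, OF A] by (simp add: Z_def c_def)
  then have nz: "Z y \<noteq> 0" for y by (metis less_irrefl)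
  have DZ: "(Z has_derivative (\<lambda>h. \<Sum>i\<in>UNIV. h $ i * g i y)) (at y)" for y
    unfolding Z_def g_def by (rule word_series_has_derivative[OF gc])
  have Dg: "(g j has_derivative (\<lambda>h. \<Sum>i\<in>UNIV. h $ i * word_series (word_deriv i (word_deriv j c)) y)) (at y)" for j y
    unfolding g_def by (rule word_series_has_derivative[OF geometric_growth_word_deriv[OF gc]])
  have f: "log_partition A b = (\<lambda>y. ln (Z y) - b \<bullet> y)"
    unfolding Z_def c_def by (rule log_partition_word_series[of A, OF A])
  have 1: "partial_deriv j (log_partition A b) = (\<lambda>y. inverse (Z y) * g j y - b $ j)" for j
  proof
    fix y
    have "((\<lambda>y. ln (Z y) - b \<bullet> y) has_derivative (\<lambda>h. (\<Sum>i\<in>UNIV. h $ i * g i y) * inverse (Z y) - b \<bullet> h)) (at y)"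
      using has_derivative_ln[OF Z DZ, of y]
      by (intro has_derivative_diff bounded_linear_imp_has_derivative bounded_linear_inner_right)
         (simp add: divide_inverse)
    from partial_deriv_eq[OF this, of j]
    show "partial_deriv j (log_partition A b) y = inverse (Z y) * g j y - b $ j"
      unfolding f sum_axis_mult by (simp add: inner_axis mult.commute)
  qed
  have "hessian (log_partition A b) y $ i $ j = inverse (Z y) * word_series (word_deriv i (word_deriv j c)) y
      - inverse (Z y) * inverse (Z y) * g i y * g j y" for i j
  proof -
    have "((\<lambda>y. inverse (Z y) * g j y - b $ j) has_derivative (\<lambda>h.
         inverse (Z y) * (\<Sum>i\<in>UNIV. h $ i * word_series (word_deriv i (word_deriv j c)) y)
        + - (inverse (Z y) * (\<Sum>i\<in>UNIV. h $ i * g i y) * inverse (Z y)) * g j y - 0)) (at y)"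
      by (intro has_derivative_diff has_derivative_mult Deriv.has_derivative_inverse nz DZ Dg has_derivative_const)
    from partial_deriv_eq[OF this, of i] show ?thesis
      unfolding sum_axis_mult by (simp add: hessian_def 1 mult_ac)
  qed
  then have "hessian (log_partition A b) y $ i $ j = hessian (log_partition A b) y $ j $ i" for i j
    by (simp add: word_deriv_commute[of i j] mult_ac)
  then show ?thesis by (simp add: symmetric_matrix_def transpose_def vec_eq_iff)
qed

lemma matrix_pencil_line: "matrix_pencil A (y + t *\<^sub>R v) = matrix_pencil A y + t *\<^sub>R matrix_pencil A v"
  by (simp add: matrix_pencil_def scaleR_add_left sum.distrib scaleR_sum_right)

text \<open>
  Shifting \<open>A(y)\<close> and \<open>A(v)\<close> by multiples of the identity changes \<open>f\<close> along the line \<open>y + t v\<close> only by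
  an affine function.  The shift of \<open>A(y)\<close> makes it positive semidefinite; the shift of \<open>A(v)\<close>
  is chosen so that the perturbed trace has a critical point at \<open>t = 0\<close>.
\<close>

lemma hessian_log_partition_ge:
  fixes A :: "'m::finite \<Rightarrow> real^'n^'n" and b y v :: "real^'m"
  assumes A: "\<And>i. symmetric_matrix (A i)"
  defines "X \<equiv> matrix_pencil A y" and "B \<equiv> matrix_pencil A v"
  shows "trace (centered B ** centered B) / (real CARD('n) * exp (lambda_max X - lambda_min X))
    \<le> v \<bullet> (hessian (log_partition A b) y *v v)"
proof -
  define f where "f = log_partition A b"
  have cd: "cont_diff k f" for k using smooth_log_partition[of A, OF A] by (simp add: f_def smooth_def)
  define \<phi>' where "\<phi>' = (\<lambda>t. \<Sum>i\<in>UNIV. v $ i * partial_deriv i f (y + t *\<^sub>R v))"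
  define H where "H = v \<bullet> (hessian f y *v v)"
  have \<phi>': "((\<lambda>t. f (y + t *\<^sub>R v)) has_real_derivative \<phi>' t) (at t)" for t
    unfolding \<phi>'_def by (rule directional_derivative[OF cd[of "Suc 0"]])
  have \<phi>'': "(\<phi>' has_real_derivative H) (at 0)"
    using second_directional_derivative[OF cd[of 2], of v y 0] unfolding \<phi>'_def H_def by simp
  have symX: "symmetric_matrix X" and symB: "symmetric_matrix B"
    unfolding X_def B_def by (rule symmetric_matrix_pencil[of A, OF A])+
  define l where "l = lambda_min X"
  \<comment> \<open>This is the mean of \<open>A(v)\<close> in the Gibbs state of \<open>A(y)\<close>; taking it from the derivative of \<open>f\<close>
    makes \<open>\<psi>'\<close> vanish at \<open>0\<close> and needs no formula for the gradient.\<close>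
  define c where "c = \<phi>' 0 + b \<bullet> v"
  define P where "P = X - l *\<^sub>R mat 1"
  define C where "C = B - c *\<^sub>R mat 1"
  have symP: "symmetric_matrix P" and symC: "symmetric_matrix C"
    unfolding P_def C_def by (intro symmetric_matrix_simps symX symB)+
  have psdP: "psd P"
    using lambda_bounds_quadratic_form(2)[OF symX] symP
    by (simp add: psd_def P_def l_def matrix_vector_mult_diff_rdistrib scaleR_matrix_vector_assoc[symmetric]
        inner_diff_right)
  define \<psi> where "\<psi> = (\<lambda>t. trace (matrix_exp (P + t *\<^sub>R C)))"
  obtain \<psi>' \<psi>'' where \<psi>': "\<And>t. (\<psi> has_real_derivative \<psi>' t) (at t)"
    and \<psi>'': "(\<psi>' has_real_derivative \<psi>'') (at 0)" and ge: "trace (C ** C) \<le> \<psi>''"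
    unfolding \<psi>_def by (rule trace_exp_perturbation[OF psdP symC]) blast
  have symPC: "symmetric_matrix (P + t *\<^sub>R C)" for t by (intro symmetric_matrix_simps symP symC)
  have pos: "\<psi> t > 0" for t unfolding \<psi>_def by (rule trace_matrix_exp_pos[OF symPC])
  have f_eq: "f (y + t *\<^sub>R v) = l + t * c + ln (\<psi> t) - b \<bullet> y - t * (b \<bullet> v)" for t
  proof -
    have "matrix_pencil A (y + t *\<^sub>R v) = (P + t *\<^sub>R C) + (l + t * c) *\<^sub>R mat 1"
      by (simp add: matrix_pencil_line P_def C_def X_def[symmetric] B_def[symmetric]
          scaleR_right_diff_distrib scaleR_add_left)
    then have "trace (matrix_exp (matrix_pencil A (y + t *\<^sub>R v))) = exp (l + t * c) * \<psi> t"
      by (simp only: trace_matrix_exp_shift[OF symPC] \<psi>_def)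
    then show ?thesis
      using pos[of t] by (simp add: f_def log_partition_def ln_mult inner_add_right)
  qed
  have \<phi>'_eq: "\<phi>' t = c + \<psi>' t / \<psi> t - b \<bullet> v" for t
  proof (rule DERIV_unique[OF \<phi>'])
    have "((\<lambda>t. l + t * c + ln (\<psi> t) - b \<bullet> y - t * (b \<bullet> v)) has_real_derivative c + \<psi>' t / \<psi> t - b \<bullet> v) (at t)"
      using pos[of t] by (auto intro!: derivative_eq_intros \<psi>')
    then show "((\<lambda>t. f (y + t *\<^sub>R v)) has_real_derivative c + \<psi>' t / \<psi> t - b \<bullet> v) (at t)"
      by (simp only: f_eq)
  qed
  have "\<psi>' 0 / \<psi> 0 = 0" using \<phi>'_eq[of 0] by (simp add: c_def)
  then have crit: "\<psi>' 0 = 0" using pos[of 0] by simp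
  have "H = \<psi>'' / \<psi> 0"
  proof (rule DERIV_unique[OF \<phi>''])
    have "((\<lambda>t. c + \<psi>' t / \<psi> t - b \<bullet> v) has_real_derivative \<psi>'' / \<psi> 0) (at 0)"
      using pos[of 0] crit by (auto intro!: derivative_eq_intros \<psi>' \<psi>'')
    then show "(\<phi>' has_real_derivative \<psi>'' / \<psi> 0) (at 0)"
      using \<phi>'_eq by presburger
  qed
  define N where "N = real CARD('n) * exp (lambda_max X - lambda_min X)"
  have "\<psi> 0 \<le> N"
  proof -
    have "X = P + l *\<^sub>R mat 1" by (simp add: P_def)
    then have "trace (matrix_exp X) = exp l * \<psi> 0"
      using trace_matrix_exp_shift[OF symP, of l] by (simp add: \<psi>_def)
    then have "exp l * \<psi> 0 \<le> real CARD('n) * exp (lambda_max X)"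
      using trace_matrix_exp_bounds(2)[OF symX] by simp
    then show ?thesis by (simp add: N_def l_def exp_diff field_simps)
  qed
  moreover have "trace (centered B ** centered B) \<le> \<psi>''"
    using trace_square_centered_le[OF symB, of c] ge by (simp add: C_def)
  moreover have "0 \<le> trace (centered B ** centered B)"
  proof -
    obtain u d where E: "eigenbasis B u d" using eigenbasis_exists[OF symB] by blast
    show ?thesis unfolding centered_def trace_square_eigenbasis[OF E] by (simp add: sum_nonneg)
  qed
  ultimately have "trace (centered B ** centered B) / N \<le> \<psi>'' / \<psi> 0"
    using pos[of 0] by (intro frac_le) auto
  then show ?thesis using \<open>H = \<psi>'' / \<psi> 0\<close> by (simp add: N_def H_def f_def)
qed

lemma convex_sublevel_if_hessian_nonneg:
  fixes f :: "real^'m::finite \<Rightarrow> real"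
  assumes f: "cont_diff 2 f" and H: "\<And>y v. 0 \<le> v \<bullet> (hessian f y *v v)"
  shows "convex {y. f y \<le> r}"
proof (rule convexI, unfold mem_Collect_eq)
  fix x y :: "real^'m" and s t :: real
  assume x: "f x \<le> r" and y: "f y \<le> r" and st: "0 \<le> s" "0 \<le> t" "s + t = 1"
  have f1: "cont_diff (Suc (Suc 0)) f" using f by (simp add: numeral_2_eq_2)
  have "convex_on UNIV (\<lambda>t. f (x + t *\<^sub>R (y - x)))"
    by (rule f''_ge0_imp_convex[OF _ directional_derivative[OF f1] second_directional_derivative[OF f] H]) simp
  from convex_onD[OF this, of t 0 1] st
  have "f (x + t *\<^sub>R (y - x)) \<le> (1 - t) * f x + t * f y" by simp
  also have "\<dots> \<le> (1 - t) * r + t * r"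
    using x y st by (intro add_mono mult_left_mono) auto
  also have "x + t *\<^sub>R (y - x) = s *\<^sub>R x + t *\<^sub>R y"
  proof -
    have "s = 1 - t" using st by linarith
    show ?thesis unfolding \<open>s = 1 - t\<close> by (simp add: algebra_simps)
  qed
  finally show "f (s *\<^sub>R x + t *\<^sub>R y) \<le> r" by (simp add: algebra_simps)
qed

section \<open>The moment body and its support function\<close>

lemma trace_matrix_pencil_mult:
  "trace (matrix_pencil A v ** X) = v \<bullet> moment_map A X"
proof -
  have lin: "linear (\<lambda>Y. trace (Y ** X))"
    by (intro linearI)
      (simp_all add: trace_def matrix_matrix_mult_def sum_distrib_left distrib_right sum.distrib mult.assoc)
  show ?thesis
    unfolding matrix_pencil_def linear_sum[OF lin] linear_cmul[OF lin]
    by (simp add: moment_map_def inner_vec_def)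
qed

text \<open>
  The difference of the two sides is the trace of the product of the positive semidefinite
  matrices \<open>\<lambda>\<^sub>m\<^sub>a\<^sub>x I - B\<close> and \<open>X\<close>.
\<close>

lemma trace_mult_le_lambda_max:
  fixes B X :: "real^'n^'n"
  assumes B: "symmetric_matrix B" and X: "X \<in> spectraplex"
  shows "trace (B ** X) \<le> lambda_max B"
proof -
  have "psd (lambda_max B *\<^sub>R mat 1 - B)"
    using lambda_bounds_quadratic_form(1)[OF B]
    by (simp add: psd_def B symmetric_matrix_simps matrix_vector_mult_diff_rdistrib
        scaleR_matrix_vector_assoc[symmetric] inner_diff_right)
  then have "0 \<le> trace ((lambda_max B *\<^sub>R mat 1 - B) ** X)"
    using X by (intro trace_psd_mult_nonneg) (auto simp: spectraplex_def)
  also have "(lambda_max B *\<^sub>R mat 1 - B) ** X = lambda_max B *\<^sub>R X - B ** X"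
    by (intro matrix_eq[THEN iffD2] allI)
      (simp add: matrix_vector_mul_assoc[symmetric] matrix_vector_mult_diff_rdistrib scaleR_matrix_vector_assoc[symmetric])
  also have "trace (lambda_max B *\<^sub>R X - B ** X) = lambda_max B - trace (B ** X)"
    using X by (simp add: trace_sub trace_scaleR spectraplex_def)
  finally show ?thesis by simp
qed

text \<open>
  The maximum is attained at the projection onto an eigenvector for the largest eigenvalue.
\<close>

lemma trace_mult_attains_lambda_max:
  fixes B :: "real^'n^'n"
  assumes B: "symmetric_matrix B"
  obtains X where "X \<in> spectraplex" "trace (B ** X) = lambda_max B"
proof -
  obtain v where v: "norm v = 1" "B *v v = lambda_max B *\<^sub>R v"
    using lambda_max_attained[OF B] by blast
  define X :: "real^'n^'n" where "X = (\<chi> p q. v $ p * v $ q)"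
  have vv: "v \<bullet> v = 1" using v(1) by (simp add: norm_eq_1)
  have Xw: "X *v w = (v \<bullet> w) *\<^sub>R v" for w
    by (simp add: vec_eq_iff X_def matrix_vector_mult_def inner_vec_def sum_distrib_left mult_ac)
  have "symmetric_matrix X" by (simp add: symmetric_matrix_def X_def transpose_def vec_eq_iff mult.commute)
  then have "psd X" by (simp add: psd_def Xw inner_commute)
  moreover have "trace X = 1" using vv by (simp add: trace_def X_def inner_vec_def)
  ultimately have "X \<in> spectraplex" by (simp add: spectraplex_def)
  moreover have "trace (B ** X) = v \<bullet> (B *v v)"
    by (simp add: trace_def matrix_matrix_mult_def matrix_vector_mult_def X_def inner_vec_def sum_distrib_left mult_ac)
  then have "trace (B ** X) = lambda_max B" using vv by (simp add: v)
  ultimately show ?thesis by (rule that)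
qed

lemma trace_square_symmetric:
  fixes Y :: "real^'n^'n"
  assumes "symmetric_matrix Y"
  shows "trace (Y ** Y) = (norm Y)\<^sup>2"
proof -
  have "Y $ i $ j = Y $ j $ i" for i j
    using assms by (simp add: symmetric_matrix_def transpose_def vec_eq_iff)
  then show ?thesis
    by (simp add: power2_norm_eq_inner inner_vec_def trace_def matrix_matrix_mult_def)
qed

lemma norm_spectraplex_le_1:
  fixes X :: "real^'n^'n"
  assumes "X \<in> spectraplex"
  shows "norm X \<le> 1"
proof -
  have X: "psd X" "trace X = 1" and sym: "symmetric_matrix X"
    using assms by (auto simp: spectraplex_def psd_def)
  obtain u d where E: "eigenbasis X u d" using eigenbasis_exists[OF sym] by blast
  have "d i = u i \<bullet> (X *v u i)" for i using E by (simp add: eigenbasis_def)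
  then have d0: "d i \<ge> 0" for i using X(1) by (simp add: psd_def)
  have d1: "(\<Sum>i\<in>UNIV. d i) = 1"
    using E X(2) by (simp add: eigenbasis_trace[OF E] eigenbasis_def)
  have "d i \<le> 1" for i
    using member_le_sum[of i UNIV d] d0 d1 by simp
  then have "(\<Sum>i\<in>UNIV. (d i)\<^sup>2) \<le> (\<Sum>i\<in>UNIV. d i)"
    using d0 by (intro sum_mono) (simp add: power2_eq_square mult_left_le)
  then have "(norm X)\<^sup>2 \<le> 1"
    using trace_square_eigenbasis[OF E, of 0] d1 by (simp add: trace_square_symmetric[OF sym])
  then show ?thesis by (simp add: power_le_one_iff abs_square_le_1)
qed

lemma linear_trace: "linear (trace :: real^'n^'n \<Rightarrow> real)"
  by (intro linearI) (simp_all add: trace_add trace_scaleR)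

lemma linear_quadratic_form: "linear (\<lambda>X :: real^'n^'n. v \<bullet> (X *v v))"
  by (intro linearI) (simp_all add: matrix_vector_mult_add_rdistrib scaleR_matrix_vector_assoc[symmetric] inner_add_right)

lemma linear_transpose: "linear (transpose :: real^'n^'n \<Rightarrow> real^'n^'n)"
  by (intro linearI) (simp_all add: transpose_def vec_eq_iff)

lemma linear_moment_map: "linear (moment_map A)"
  by (intro linearI)
    (simp_all add: moment_map_def vec_eq_iff trace_def matrix_matrix_mult_def sum_distrib_left distrib_left sum.distrib mult_ac)

lemma compact_spectraplex: "compact (spectraplex :: (real^'n^'n) set)"
proof -
  have "spectraplex = {X :: real^'n^'n. transpose X = X} \<inter> (\<Inter>v. {X. 0 \<le> v \<bullet> (X *v v)}) \<inter> {X. trace X = 1}"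
    by (auto simp: spectraplex_def psd_def symmetric_matrix_def)
  also have "closed \<dots>"
    by (intro closed_Int closed_INT ballI closed_Collect_eq closed_Collect_le continuous_on_const continuous_on_id
        linear_continuous_on linear_conv_bounded_linear[THEN iffD1] linear_trace linear_quadratic_form linear_transpose)
  finally have "closed (spectraplex :: (real^'n^'n) set)" .
  moreover have "bounded (spectraplex :: (real^'n^'n) set)"
    using norm_spectraplex_le_1 by (auto intro: boundedI)
  ultimately show ?thesis by (simp add: compact_eq_bounded_closed)
qed

lemma convex_spectraplex: "convex (spectraplex :: (real^'n^'n) set)"
proof (rule convexI)
  fix X Y :: "real^'n^'n" and s t :: real
  assume X: "X \<in> spectraplex" and Y: "Y \<in> spectraplex" and st: "0 \<le> s" "0 \<le> t" "s + t = 1"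
  have "psd (s *\<^sub>R X + t *\<^sub>R Y)"
    using X Y st by (auto simp: spectraplex_def psd_def symmetric_matrix_simps matrix_vector_mult_add_rdistrib
       scaleR_matrix_vector_assoc[symmetric] inner_add_right)
  moreover have "trace (s *\<^sub>R X + t *\<^sub>R Y) = 1"
    using X Y st by (simp add: spectraplex_def trace_add trace_scaleR)
  ultimately show "s *\<^sub>R X + t *\<^sub>R Y \<in> spectraplex" by (simp add: spectraplex_def)
qed

lemma compact_convex_moment_body: "compact (moment_body A)" "convex (moment_body A)"
  unfolding moment_body_def
  by (intro compact_continuous_image linear_continuous_on linear_conv_bounded_linear[THEN iffD1]
      linear_moment_map compact_spectraplex)
     (intro convex_linear_image linear_moment_map convex_spectraplex)

text \<open>
  As \<open>v \<bullet> \<A>(X) = tr (A(v) X)\<close>, the support function of the moment body at \<open>v\<close> is the largest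
  eigenvalue of \<open>A(v)\<close>.
\<close>

lemma moment_body_support:
  assumes A: "\<And>i. symmetric_matrix (A i)"
  shows "x \<in> moment_body A \<Longrightarrow> v \<bullet> x \<le> lambda_max (matrix_pencil A v)"
    and "\<exists>x\<in>moment_body A. v \<bullet> x = lambda_max (matrix_pencil A v)"
proof -
  have sym: "symmetric_matrix (matrix_pencil A v)" by (rule symmetric_matrix_pencil[of A, OF A])
  show "v \<bullet> x \<le> lambda_max (matrix_pencil A v)" if "x \<in> moment_body A"
    using that trace_mult_le_lambda_max[OF sym] by (auto simp: moment_body_def trace_matrix_pencil_mult)
  obtain X where "X \<in> spectraplex" "trace (matrix_pencil A v ** X) = lambda_max (matrix_pencil A v)"
    by (rule trace_mult_attains_lambda_max[OF sym])
  then show "\<exists>x\<in>moment_body A. v \<bullet> x = lambda_max (matrix_pencil A v)"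
    unfolding moment_body_def trace_matrix_pencil_mult by blast
qed

text \<open>
  Here \<open>h\<close> is the support function of \<open>M\<close>.  The open ball around \<open>b\<close> that reaches to the frontier is
  connected and misses the frontier, so it lies in \<open>M\<close>; hence for unit \<open>v\<close> the value \<open>h v\<close> exceeds \<open>b \<bullet> v\<close> by at
  least the radius.  Equality holds for the outer unit normal of a supporting hyperplane at a frontier point
  nearest to \<open>b\<close>.
\<close>

lemma infdist_frontier_is_minimum_support:
  fixes M :: "'a::euclidean_space set"
  assumes M: "compact M" "convex M" and b: "b \<in> interior M"
    and h_ge: "\<And>v x. x \<in> M \<Longrightarrow> v \<bullet> x \<le> h v" and h_attained: "\<And>v. \<exists>x\<in>M. v \<bullet> x = h v"
  shows "0 < infdist b (frontier M)"
    and "is_minimum_on (infdist b (frontier M)) (\<lambda>v. h v - b \<bullet> v) (sphere 0 1)"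
proof -
  define \<delta> where "\<delta> = infdist b (frontier M)"
  have bM: "b \<in> M" using b interior_subset by blast
  have "M \<noteq> UNIV" using M(1) compact_imp_bounded not_bounded_UNIV by blast
  then have ne: "frontier M \<noteq> {}" using bM frontier_eq_empty by blast
  have "b \<notin> frontier M" using b by (simp add: frontier_def)
  then show pos: "0 < infdist b (frontier M)"
    by (intro infdist_pos_not_in_closed frontier_closed ne)
  have ball: "ball b \<delta> \<subseteq> M"
  proof (rule ccontr)
    assume "\<not> ball b \<delta> \<subseteq> M"
    then have "ball b \<delta> - M \<noteq> {}" by blast
    moreover have "b \<in> ball b \<delta> \<inter> M" using pos bM by (simp add: \<delta>_def)
    then have "ball b \<delta> \<inter> M \<noteq> {}" by blast
    ultimately have "ball b \<delta> \<inter> frontier M \<noteq> {}"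
      by (intro connected_Int_frontier connected_ball)
    then obtain x where "x \<in> frontier M" "dist b x < \<delta>" by auto
    then show False using infdist_le[of x "frontier M" b] by (simp add: \<delta>_def)
  qed
  have ge: "\<delta> \<le> h v - b \<bullet> v" if v: "norm v = 1" for v
  proof (rule ccontr)
    assume lt: "\<not> \<delta> \<le> h v - b \<bullet> v"
    have "0 \<le> h v - b \<bullet> v" using h_ge[OF bM, of v] by (simp add: inner_commute)
    with lt obtain r where r: "h v - b \<bullet> v < r" "r < \<delta>" "0 < r"
      using dense[of "h v - b \<bullet> v" \<delta>] by force
    have "b + r *\<^sub>R v \<in> ball b \<delta>" using r v by (simp add: dist_norm)
    then have "v \<bullet> (b + r *\<^sub>R v) \<le> h v" using ball h_ge by blast
    moreover have "v \<bullet> v = 1" using v by (simp add: norm_eq_1)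
    ultimately show False using r by (simp add: inner_add_right inner_commute)
  qed
  obtain x where x: "x \<in> frontier M" "\<delta> = dist b x"
    using infdist_attains_inf[OF frontier_closed ne] unfolding \<delta>_def by blast
  have xM: "x \<in> M" and "x \<notin> interior M"
    using x(1) M(1) by (auto simp: frontier_def compact_imp_closed)
  moreover have "rel_interior M = interior M" using b by (intro rel_interior_nonempty_interior) blast
  ultimately have "x \<notin> rel_interior M" by simp
  then obtain a where a: "a \<noteq> 0" "\<And>y. y \<in> M \<Longrightarrow> a \<bullet> x \<le> a \<bullet> y"
    by (rule supporting_hyperplane_rel_boundary[OF M(2) xM]) blast
  define v where "v = - (a /\<^sub>R norm a)"
  have v: "norm v = 1" using a(1) by (simp add: v_def)
  obtain y where y: "y \<in> M" "v \<bullet> y = h v" using h_attained by blast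
  have "v \<bullet> y \<le> v \<bullet> x" using a(2)[OF y(1)] by (simp add: v_def mult_left_mono)
  then have "h v \<le> v \<bullet> x" by (simp only: y(2))
  then have "h v - b \<bullet> v \<le> v \<bullet> (x - b)" by (simp add: inner_diff_right inner_commute)
  also have "\<dots> \<le> norm v * norm (x - b)" by (rule norm_cauchy_schwarz)
  also have "\<dots> = \<delta>" using v x(2) by (simp add: dist_norm norm_minus_commute)
  finally have "h v - b \<bullet> v = \<delta>" using ge[OF v] by simp
  then show "is_minimum_on (infdist b (frontier M)) (\<lambda>v. h v - b \<bullet> v) (sphere 0 1)"
    unfolding is_minimum_on_def \<delta>_def[symmetric] using v ge by (auto intro!: image_eqI[of _ _ v])
qed

section \<open>The centered Gram matrix\<close>

lemma centered_matrix_pencil: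
  "centered (matrix_pencil A v) = matrix_pencil (\<lambda>i. centered (A i)) v"
proof -
  have lin: "linear (centered :: real^'n^'n \<Rightarrow> _)"
    by (intro linearI)
      (simp_all add: centered_def trace_add trace_scaleR scaleR_add_left scaleR_right_diff_distrib add_divide_distrib)
  show ?thesis by (simp add: matrix_pencil_def linear_sum[OF lin] linear_cmul[OF lin])
qed

lemma centered_gram_quadratic_form:
  "v \<bullet> (centered_gram A *v v) = trace (centered (matrix_pencil A v) ** centered (matrix_pencil A v))"
proof -
  let ?c = "\<lambda>i. centered (A i)"
  have *: "trace (matrix_pencil ?c v ** X) = (\<Sum>i\<in>UNIV. v $ i * trace (?c i ** X))" for X
    by (simp add: trace_matrix_pencil_mult moment_map_def inner_vec_def)
  have "trace (?c i ** matrix_pencil ?c v) = (\<Sum>j\<in>UNIV. v $ j * trace (?c i ** ?c j))" for i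
    unfolding trace_mul_sym[of "?c i" "matrix_pencil ?c v"] *
    by (intro sum.cong refl arg_cong[of _ _ "\<lambda>x. _ * x"] trace_mul_sym)
  then show ?thesis
    unfolding centered_matrix_pencil *
    by (simp add: inner_vec_def centered_gram_def matrix_vector_mult_def mult.commute)
qed

lemma symmetric_centered: "symmetric_matrix X \<Longrightarrow> symmetric_matrix (centered X)"
  unfolding centered_def by (intro symmetric_matrix_simps)

lemma symmetric_centered_gram: "symmetric_matrix (centered_gram A)"
  by (simp add: symmetric_matrix_def centered_gram_def transpose_def vec_eq_iff)
    (intro allI trace_mul_sym)

text \<open>
  A vanishing centered pencil would express \<open>A(v)\<close> as a multiple of the identity.
\<close>

lemma independent_family_centered_pencil_nonzero:
  fixes A :: "'m::finite \<Rightarrow> real^'n^'n"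
  assumes ind: "independent_family (case_option (mat 1) A)" and v: "v \<noteq> 0"
  shows "centered (matrix_pencil A v) \<noteq> 0"
proof
  assume 0: "centered (matrix_pencil A v) = 0"
  let ?F = "case_option (mat 1) A"
  define k where "k = case_option (- (trace (matrix_pencil A v) / real CARD('n))) (\<lambda>i. v $ i)"
  have inj: "inj ?F" and indep: "independent (range ?F)"
    using ind by (auto simp: independent_family_def)
  have "(\<Sum>X\<in>range ?F. k (inv ?F X) *\<^sub>R X) = (\<Sum>l\<in>UNIV. k l *\<^sub>R ?F l)"
    by (simp only: sum.reindex[OF inj] o_def inv_f_f[OF inj])
  also have "\<dots> = k None *\<^sub>R mat 1 + (\<Sum>i\<in>UNIV. k (Some i) *\<^sub>R A i)"
    by (simp add: UNIV_option_conv sum.reindex)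
  also have "\<dots> = 0" using 0 by (simp add: k_def centered_def matrix_pencil_def)
  finally have zero: "(\<Sum>X\<in>range ?F. k (inv ?F X) *\<^sub>R X) = 0" .
  have "k (inv ?F (?F (Some i))) = 0" for i
    using finite_imageI[OF finite] zero rangeI by (rule independentD[OF indep _ order_refl])
  then have "v $ i = 0" for i by (simp only: inv_f_f[OF inj]) (simp add: k_def)
  then show False using v by (simp add: vec_eq_iff)
qed

lemma lambda_min_centered_gram_pos:
  fixes A :: "'m::finite \<Rightarrow> real^'n^'n"
  assumes A: "\<And>i. symmetric_matrix (A i)" and ind: "independent_family (case_option (mat 1) A)"
  shows "0 < lambda_min (centered_gram A)"
proof -
  obtain v where v: "norm v = 1" "centered_gram A *v v = lambda_min (centered_gram A) *\<^sub>R v"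
    by (rule lambda_min_attained[OF symmetric_centered_gram])
  let ?C = "centered (matrix_pencil A v)"
  have "v \<bullet> v = 1" using v(1) by (simp add: norm_eq_1)
  then have "lambda_min (centered_gram A) = trace (?C ** ?C)"
    using centered_gram_quadratic_form[of v A] by (simp add: v(2))
  also have "\<dots> = (norm ?C)\<^sup>2"
    by (intro trace_square_symmetric symmetric_centered symmetric_matrix_pencil A)
  also have "\<dots> > 0"
  proof -
    have "v \<noteq> 0" using v(1) by auto
    then show ?thesis using independent_family_centered_pencil_nonzero[OF ind] by simp
  qed
  finally show ?thesis .
qed

section \<open>Strong convexity on sublevel sets\<close>

text \<open>
  By homogeneity, \<open>\<delta>\<close> times the norm of \<open>y\<close> bounds \<open>\<lambda>\<^sub>m\<^sub>a\<^sub>x(A(y)) - b \<bullet> y\<close> from below, and the logarithm of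
  the trace of the exponential is at least the largest eigenvalue.
\<close>

lemma log_partition_ge:
  fixes A :: "'m::finite \<Rightarrow> real^'n^'n"
  assumes A: "\<And>i. symmetric_matrix (A i)"
    and \<delta>: "\<And>v. norm v = 1 \<Longrightarrow> \<delta> \<le> lambda_max (matrix_pencil A v) - b \<bullet> v"
  shows "\<delta> * norm y \<le> log_partition A b y"
proof -
  have sym: "symmetric_matrix (matrix_pencil A y)" for y by (rule symmetric_matrix_pencil[of A, OF A])
  have "\<delta> * norm y \<le> lambda_max (matrix_pencil A y) - b \<bullet> y"
  proof -
    obtain v where v: "norm v = 1" "y = norm y *\<^sub>R v"
    proof (cases "y = 0")
      case True
      obtain e :: "real^'m" where "norm e = 1" by (metis vector_choose_size zero_le_one)
      then show ?thesis using that True by simp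
    next
      case False
      then show ?thesis using that[of "y /\<^sub>R norm y"] by simp
    qed
    have "matrix_pencil A (norm y *\<^sub>R v) = norm y *\<^sub>R matrix_pencil A v"
      by (simp add: matrix_pencil_def scaleR_sum_right)
    then have "lambda_max (matrix_pencil A (norm y *\<^sub>R v)) = norm y * lambda_max (matrix_pencil A v)"
      by (simp add: lambda_max_scaleR[OF sym])
    moreover have "b \<bullet> (norm y *\<^sub>R v) = norm y * (b \<bullet> v)" by simp
    ultimately have "lambda_max (matrix_pencil A y) - b \<bullet> y = norm y * (lambda_max (matrix_pencil A v) - b \<bullet> v)"
      using v(2) by (simp add: right_diff_distrib)
    then show ?thesis using mult_left_mono[OF \<delta>[OF v(1)], of "norm y"] by (simp add: mult.commute)
  qed
  also have "lambda_max (matrix_pencil A y) \<le> ln (trace (matrix_exp (matrix_pencil A y)))"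
    using trace_matrix_exp_bounds(1)[OF sym, of y] trace_matrix_exp_pos[OF sym, of y] by (simp add: ln_ge_iff)
  finally show ?thesis by (simp add: log_partition_def)
qed

lemma eigenvalue_spread_pencil_le:
  fixes A :: "'m::finite \<Rightarrow> real^'n^'n"
  assumes A: "\<And>i. symmetric_matrix (A i)"
  shows "lambda_max (matrix_pencil A y) - lambda_min (matrix_pencil A y)
    \<le> sqrt (2 * lambda_max (centered_gram A)) * norm y"
proof -
  have "trace (centered (matrix_pencil A y) ** centered (matrix_pencil A y)) \<le> lambda_max (centered_gram A) * (norm y)\<^sup>2"
    using lambda_bounds_quadratic_form(1)[OF symmetric_centered_gram, of y A]
    by (simp add: centered_gram_quadratic_form power2_norm_eq_inner)
  then have "sqrt (2 * trace (centered (matrix_pencil A y) ** centered (matrix_pencil A y)))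
      \<le> sqrt (2 * lambda_max (centered_gram A) * (norm y)\<^sup>2)"
    by (intro real_sqrt_le_mono) simp
  also have "\<dots> = sqrt (2 * lambda_max (centered_gram A)) * norm y"
    by (simp add: real_sqrt_mult)
  finally show ?thesis
    using eigenvalue_spread_le[OF symmetric_matrix_pencil[of A y, OF A]] by linarith
qed

theorem lemma8:
  fixes A :: "'m::finite \<Rightarrow> real^'n^'n"
    and b y0 :: "real^'m"
    and f :: "real^'m \<Rightarrow> real"
    and S :: "(real^'m) set"
    and \<delta> \<alpha> :: real
  assumes "\<And>i. symmetric_matrix (A i)"
    and "independent_family (case_option (mat 1) A)"
    and "b \<in> interior (moment_body A)"
  defines "f \<equiv> log_partition A b"
    and "S \<equiv> {y. f y \<le> f y0}"
    and "\<delta> \<equiv> infdist b (frontier (moment_body A))"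
    and "\<alpha> \<equiv> lambda_min (centered_gram A) / real CARD('n)
               * exp (- (sqrt (2 * lambda_max (centered_gram A)) / \<delta> * f y0))"
  shows "is_minimum_on \<delta> (\<lambda>v. lambda_max (matrix_pencil A v) - b \<bullet> v) (sphere 0 1)
         \<and> \<delta> > 0 \<and> \<alpha> > 0 \<and> strongly_convex_on \<alpha> S f"
proof -
  note A = assms(1)
  define G where "G = centered_gram A"
  define N where "N = real CARD('n)"
  have N: "N > 0" by (simp add: N_def)
  define \<mu> where "\<mu> = lambda_min G"
  define L where "L = sqrt (2 * lambda_max G)"
  have \<mu>: "\<mu> > 0" unfolding \<mu>_def G_def by (rule lambda_min_centered_gram_pos[of A, OF A assms(2)])
  have \<alpha>: "\<alpha> = \<mu> / N * exp (- (L / \<delta> * f y0))" by (simp add: \<alpha>_def \<mu>_def N_def L_def G_def)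
  then have \<alpha>pos: "\<alpha> > 0" using \<mu> N by simp
  have \<delta>pos: "\<delta> > 0" and \<delta>min: "is_minimum_on \<delta> (\<lambda>v. lambda_max (matrix_pencil A v) - b \<bullet> v) (sphere 0 1)"
    unfolding \<delta>_def
    using infdist_frontier_is_minimum_support[OF compact_convex_moment_body[of A] assms(3),
        of "\<lambda>v. lambda_max (matrix_pencil A v)"] moment_body_support[of A, OF A] by blast+
  have \<delta>le: "\<delta> \<le> lambda_max (matrix_pencil A v) - b \<bullet> v" if "norm v = 1" for v
    using \<delta>min that by (simp add: is_minimum_on_def)
  define E where "E = (\<lambda>y :: real^'m. N * exp (L * norm y))"
  \<comment> \<open>A bound that holds at every point; on \<open>S\<close> the norm of \<open>y\<close> is then estimated by \<open>f y0 / \<delta>\<close>.\<close>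
  have H: "\<mu> * (v \<bullet> v) / E y \<le> v \<bullet> (hessian f y *v v)" for y v :: "real^'m"
  proof -
    let ?X = "matrix_pencil A y"
    have "\<mu> * (v \<bullet> v) \<le> trace (centered (matrix_pencil A v) ** centered (matrix_pencil A v))"
      using lambda_bounds_quadratic_form(2)[OF symmetric_centered_gram, of A v]
      by (simp add: \<mu>_def G_def centered_gram_quadratic_form)
    moreover have "N * exp (lambda_max ?X - lambda_min ?X) \<le> E y"
      using eigenvalue_spread_pencil_le[of A, OF A, of y] N by (simp add: E_def L_def G_def)
    moreover have "0 \<le> \<mu> * (v \<bullet> v)" using \<mu> by simp
    moreover have "0 < N * exp (lambda_max ?X - lambda_min ?X)" using N by simp
    ultimately have "\<mu> * (v \<bullet> v) / E y
        \<le> trace (centered (matrix_pencil A v) ** centered (matrix_pencil A v)) / (N * exp (lambda_max ?X - lambda_min ?X))"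
      by (intro frac_le) auto
    also have "\<dots> \<le> v \<bullet> (hessian f y *v v)"
      unfolding f_def N_def by (rule hessian_log_partition_ge[of A, OF A])
    finally show ?thesis .
  qed
  have smooth: "smooth f" unfolding f_def by (rule smooth_log_partition[of A, OF A])
  have "convex S" unfolding S_def
  proof (rule convex_sublevel_if_hessian_nonneg)
    show "cont_diff 2 f" using smooth by (simp add: smooth_def)
    have "0 \<le> \<mu> * (v \<bullet> v) / E y" for y v :: "real^'m" using \<mu> N by (simp add: E_def)
    then show "0 \<le> v \<bullet> (hessian f y *v v)" for y v using H order_trans by blast
  qed
  moreover have "psd (hessian f y - \<alpha> *\<^sub>R mat 1)" if y: "y \<in> S" for y
  proof -
    have "\<delta> * norm y \<le> f y0"
      using log_partition_ge[of A, OF A \<delta>le, of y] y by (simp add: f_def S_def)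
    then have "norm y \<le> f y0 / \<delta>" using \<delta>pos by (simp add: field_simps)
    moreover have "L \<ge> 0"
    proof -
      obtain v where v: "norm v = 1" "G *v v = lambda_max G *\<^sub>R v"
        unfolding G_def by (rule lambda_max_attained[OF symmetric_centered_gram])
      then have "v \<bullet> v = 1" by (simp add: norm_eq_1)
      then have "\<mu> \<le> lambda_max G"
        using lambda_bounds_quadratic_form(2)[OF symmetric_centered_gram, of A v] v(2) by (simp add: \<mu>_def G_def)
      then show ?thesis using \<mu> by (simp add: L_def)
    qed
    ultimately have "L * norm y \<le> L / \<delta> * f y0"
      using mult_left_mono[of "norm y" "f y0 / \<delta>" L] by simp
    then have "\<alpha> \<le> \<mu> / E y"
      using \<mu> N by (simp add: \<alpha> E_def exp_minus field_simps)
    then have "\<alpha> * (v \<bullet> v) \<le> \<mu> * (v \<bullet> v) / E y" for v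
      using mult_right_mono[of \<alpha> "\<mu> / E y" "v \<bullet> v"] by simp
    then have "\<alpha> * (v \<bullet> v) \<le> v \<bullet> (hessian f y *v v)" for v using H[of v y] by (rule order_trans)
    moreover have "symmetric_matrix (hessian f y - \<alpha> *\<^sub>R mat 1)"
      unfolding f_def by (intro symmetric_matrix_simps symmetric_hessian_log_partition A)
    ultimately show ?thesis
      by (simp add: psd_def matrix_vector_mult_diff_rdistrib scaleR_matrix_vector_assoc[symmetric] inner_diff_right)
  qed
  ultimately show ?thesis using \<delta>min \<delta>pos \<alpha>pos smooth by (simp add: strongly_convex_on_def)
qed

end
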